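(* For every integer $k\ge 0$, the neighborhood complex $\mathcal{N}(KG_{3,k})$ of the Kneser graph $KG_{3,k}$ is homotopy equivalent to a wedge of $\frac{(k+1)(k+3)(k+4)(k+6)}{4}+1$ copies of the $k$-sphere $S^k$.
   Context: For a positive integer $n$, $[n]=\{1,\dots,n\}$. The Kneser graph $KG_{3,k}$ has as vertices the $3$-element subsets of $[k+6]$, two vertices being adjacent iff they are disjoint. For a graph $G$, the neighborhood complex $\mathcal{N}(G)$ is the simplicial complex whose vertices are the non-isolated vertices of $G$ and whose simplices are the nonempty sets of vertices having a common neighbor in $G$. *)

theory Defs
  imports "HOL-Analysis.Analysis"
begin

section \<open>Graphs and neighborhood complexes\<close>

type_synonym 'v graph = "'v set \<times> 'v set set"

abbreviation graph_verts :: "'v graph \<Rightarrow> 'v set" where "graph_verts \<equiv> fst"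
abbreviation graph_edges :: "'v graph \<Rightarrow> 'v set set" where "graph_edges \<equiv> snd"

definition adjacent :: "'v graph \<Rightarrow> 'v \<Rightarrow> 'v \<Rightarrow> bool" where
  "adjacent G u v \<longleftrightarrow> u \<in> graph_verts G \<and> v \<in> graph_verts G \<and> {u, v} \<in> graph_edges G"

definition kneser_verts :: "nat \<Rightarrow> nat \<Rightarrow> nat set set" where
  "kneser_verts n k = {A. A \<subseteq> {1..2 * n + k} \<and> card A = n}"

definition kneser_graph :: "nat \<Rightarrow> nat \<Rightarrow> nat set graph" where
  "kneser_graph n k =
     (kneser_verts n k,
      {{A, B} | A B. A \<in> kneser_verts n k \<and> B \<in> kneser_verts n k \<and> A \<inter> B = {}})"

text \<open>An abstract simplicial complex is represented by its set of simplices; the vertex set is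
  the union of the simplices.\<close>

definition neighborhood_complex :: "'v graph \<Rightarrow> 'v set set" where
  "neighborhood_complex G =
     {S. S \<noteq> {} \<and> finite S \<and> S \<subseteq> graph_verts G \<and> (\<exists>w \<in> graph_verts G. \<forall>v \<in> S. adjacent G v w)}"

lemma adjacent_kneser_graph:
  "adjacent (kneser_graph n k) A B \<longleftrightarrow>
     A \<in> kneser_verts n k \<and> B \<in> kneser_verts n k \<and> A \<inter> B = {}"
  by (auto simp: adjacent_def kneser_graph_def doubleton_eq_iff)

lemma finite_kneser_verts: "finite (kneser_verts n k)"
  by (rule finite_subset[of _ "Pow {1..2 * n + k}"]) (auto simp: kneser_verts_def)

lemma Union_neighborhood_complex:
  "\<Union>(neighborhood_complex G) = {v \<in> graph_verts G. \<exists>w. adjacent G v w}"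
proof (intro equalityI subsetI)
  fix v assume "v \<in> {v \<in> graph_verts G. \<exists>w. adjacent G v w}"
  then have "{v} \<in> neighborhood_complex G"
    by (auto simp: neighborhood_complex_def adjacent_def)
  then show "v \<in> \<Union>(neighborhood_complex G)" by blast
qed (auto simp: neighborhood_complex_def)

lemma neighborhood_complex_subset:
  "S \<in> neighborhood_complex G \<Longrightarrow> T \<subseteq> S \<Longrightarrow> T \<noteq> {} \<Longrightarrow> T \<in> neighborhood_complex G"
  unfolding neighborhood_complex_def by (blast intro: finite_subset)

lemma finite_neighborhood_complex:
  "finite (graph_verts G) \<Longrightarrow> finite (neighborhood_complex G)"
  by (rule finite_subset[of _ "Pow (graph_verts G)"]) (auto simp: neighborhood_complex_def)

section \<open>Geometric realization\<close>

text \<open>Points are given by barycentric coordinates. A finite simplex carries the topology of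
  pointwise convergence, and the realization the topology coherent with its closed simplices.\<close>

definition realized_simplex :: "'v set \<Rightarrow> ('v \<Rightarrow> real) set" where
  "realized_simplex S = {x. (\<forall>v. 0 \<le> x v) \<and> (\<forall>v. v \<notin> S \<longrightarrow> x v = 0) \<and> (\<Sum>v\<in>S. x v) = 1}"

definition geometric_realization :: "'v set set \<Rightarrow> ('v \<Rightarrow> real) topology" where
  "geometric_realization K =
     topology (\<lambda>U. U \<subseteq> (\<Union>S\<in>K. realized_simplex S) \<and>
       (\<forall>S\<in>K. openin (top_of_set (realized_simplex S)) (U \<inter> realized_simplex S)))"

lemma istopology_geometric_realization:
  "istopology (\<lambda>U. U \<subseteq> (\<Union>S\<in>K. realized_simplex S) \<and>
     (\<forall>S\<in>K. openin (top_of_set (realized_simplex S)) (U \<inter> realized_simplex S)))"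
proof (unfold istopology_def, intro conjI allI impI ballI)
  fix U V S
  assume U: "U \<subseteq> (\<Union>S\<in>K. realized_simplex S) \<and>
      (\<forall>S\<in>K. openin (top_of_set (realized_simplex S)) (U \<inter> realized_simplex S))"
    and V: "V \<subseteq> (\<Union>S\<in>K. realized_simplex S) \<and>
      (\<forall>S\<in>K. openin (top_of_set (realized_simplex S)) (V \<inter> realized_simplex S))"
  then show "U \<inter> V \<subseteq> (\<Union>S\<in>K. realized_simplex S)" by blast
  assume "S \<in> K"
  then have "openin (top_of_set (realized_simplex S)) ((U \<inter> realized_simplex S) \<inter> (V \<inter> realized_simplex S))"
    using U V by (blast intro: openin_Int)
  moreover have "(U \<inter> realized_simplex S) \<inter> (V \<inter> realized_simplex S) = U \<inter> V \<inter> realized_simplex S"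
    by blast
  ultimately show "openin (top_of_set (realized_simplex S)) (U \<inter> V \<inter> realized_simplex S)"
    by simp
next
  fix \<U> S
  assume A: "\<forall>U\<in>\<U>. U \<subseteq> (\<Union>S\<in>K. realized_simplex S) \<and>
      (\<forall>S\<in>K. openin (top_of_set (realized_simplex S)) (U \<inter> realized_simplex S))"
  then show "\<Union>\<U> \<subseteq> (\<Union>S\<in>K. realized_simplex S)" by blast
  assume "S \<in> K"
  then have "openin (top_of_set (realized_simplex S)) (\<Union>U\<in>\<U>. U \<inter> realized_simplex S)"
    using A by (intro openin_Union) blast
  then show "openin (top_of_set (realized_simplex S)) (\<Union>\<U> \<inter> realized_simplex S)"
    by (simp only: Int_Union2)
qed

lemma openin_geometric_realization:
  "openin (geometric_realization K) U \<longleftrightarrow> U \<subseteq> (\<Union>S\<in>K. realized_simplex S) \<and>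
     (\<forall>S\<in>K. openin (top_of_set (realized_simplex S)) (U \<inter> realized_simplex S))"
  unfolding geometric_realization_def
  by (simp only: topology_inverse'[OF istopology_geometric_realization])

lemma topspace_geometric_realization:
  "topspace (geometric_realization K) = (\<Union>S\<in>K. realized_simplex S)"
proof
  have "(\<Union>S\<in>K. realized_simplex S) \<inter> realized_simplex T = realized_simplex T" if "T \<in> K" for T
    using that by blast
  then have "openin (geometric_realization K) (\<Union>S\<in>K. realized_simplex S)"
    unfolding openin_geometric_realization by auto
  then show "(\<Union>S\<in>K. realized_simplex S) \<subseteq> topspace (geometric_realization K)"
    by (rule openin_subset)
qed (metis openin_geometric_realization openin_topspace)

lemma closed_realized_simplex:
  fixes S :: "'v set"
  shows "closed (realized_simplex S)"
proof -
  have eq: "realized_simplex S =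
      (\<Inter>v. {x. 0 \<le> x v}) \<inter> (\<Inter>v\<in>-S. {x. x v = 0}) \<inter> {x. (\<Sum>v\<in>S. x v) = 1}"
    by (auto simp: realized_simplex_def)
  have c: "continuous_on UNIV (\<lambda>x::'v \<Rightarrow> real. x v)" for v
    by (rule continuous_on_product_coordinates)
  show ?thesis
    unfolding eq
    by (intro closed_Int closed_INT ballI closed_Collect_le closed_Collect_eq continuous_on_sum
        continuous_on_const c)
qed

lemma geometric_realization_finite:
  assumes "finite K"
  shows "geometric_realization K = top_of_set (\<Union>S\<in>K. realized_simplex S)"
proof (rule topology_eq[THEN iffD2], intro allI iffI)
  let ?X = "\<Union>S\<in>K. realized_simplex S"
  fix U
  {
    assume U: "openin (top_of_set ?X) U"
    then obtain W where W: "open W" "U = ?X \<inter> W"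
      by (auto simp: openin_open)
    then have "U \<inter> realized_simplex S = realized_simplex S \<inter> W" if "S \<in> K" for S
      using that by blast
    then show "openin (geometric_realization K) U"
      unfolding openin_geometric_realization using W by (auto simp: openin_open)
  next
    assume U: "openin (geometric_realization K) U"
    have "closed (realized_simplex S - U)" if "S \<in> K" for S
    proof -
      have "closedin (top_of_set (realized_simplex S)) (realized_simplex S - U \<inter> realized_simplex S)"
        using U that by (intro closedin_diff) (auto simp: openin_geometric_realization)
      moreover have "realized_simplex S - U \<inter> realized_simplex S = realized_simplex S - U" by blast
      ultimately show ?thesis
        using closedin_closed_trans closed_realized_simplex by metis
    qed
    then have "closed (\<Union>S\<in>K. realized_simplex S - U)"
      using assms by blast
    moreover have "U = ?X \<inter> - (\<Union>S\<in>K. realized_simplex S - U)"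
      using U unfolding openin_geometric_realization by blast
    ultimately show "openin (top_of_set ?X) U"
      unfolding openin_open by blast
  }
qed

section \<open>Wedge sums\<close>

text \<open>The relation is meant to be an equivalence on the topological space; a set of classes is open
  iff its union is.\<close>

definition quotient_topology :: "'a topology \<Rightarrow> 'a rel \<Rightarrow> 'a set topology" where
  "quotient_topology X r = topology (\<lambda>U. U \<subseteq> topspace X // r \<and> openin X (\<Union>U))"

definition wedge_rel :: "'i set \<Rightarrow> ('i \<Rightarrow> 'a topology) \<Rightarrow> ('i \<Rightarrow> 'a) \<Rightarrow> ('i \<times> 'a) rel" where
  "wedge_rel I X p =
     {(x, y). x \<in> topspace (sum_topology X I) \<and> y \<in> topspace (sum_topology X I) \<and>
        (x = y \<or> (snd x = p (fst x) \<and> snd y = p (fst y)))}"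

definition wedge_sum :: "'i set \<Rightarrow> ('i \<Rightarrow> 'a topology) \<Rightarrow> ('i \<Rightarrow> 'a) \<Rightarrow> ('i \<times> 'a) set topology" where
  "wedge_sum I X p = quotient_topology (sum_topology X I) (wedge_rel I X p)"

definition nsphere_base :: "nat \<Rightarrow> real" where
  "nsphere_base = (\<lambda>i. if i = 0 then 1 else 0)"

definition sphere_wedge :: "nat \<Rightarrow> nat \<Rightarrow> (nat \<times> (nat \<Rightarrow> real)) set topology" where
  "sphere_wedge m k = wedge_sum {..<m} (\<lambda>_. nsphere k) (\<lambda>_. nsphere_base)"

lemma Union_quotient_Int:
  assumes "equiv A r" "U \<subseteq> A // r" "V \<subseteq> A // r"
  shows "\<Union>(U \<inter> V) = \<Union>U \<inter> \<Union>V"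
  using quotient_disj[OF assms(1)] assms(2,3) by blast

lemma openin_quotient_topology:
  assumes "equiv (topspace X) r"
  shows "openin (quotient_topology X r) U \<longleftrightarrow> U \<subseteq> topspace X // r \<and> openin X (\<Union>U)"
proof -
  have "istopology (\<lambda>U. U \<subseteq> topspace X // r \<and> openin X (\<Union>U))"
  proof (unfold istopology_def, intro conjI allI impI)
    fix U V
    assume U: "U \<subseteq> topspace X // r \<and> openin X (\<Union>U)" and V: "V \<subseteq> topspace X // r \<and> openin X (\<Union>V)"
    then show "U \<inter> V \<subseteq> topspace X // r" by blast
    show "openin X (\<Union>(U \<inter> V))"
      using U V Union_quotient_Int[OF assms, of U V] by auto
  next
    fix \<U>
    assume A: "\<forall>U\<in>\<U>. U \<subseteq> topspace X // r \<and> openin X (\<Union>U)"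
    then show "\<Union>\<U> \<subseteq> topspace X // r" by blast
    have "\<Union>(\<Union>\<U>) = (\<Union>U\<in>\<U>. \<Union>U)" by blast
    then show "openin X (\<Union>(\<Union>\<U>))" using A by auto
  qed
  then show ?thesis
    unfolding quotient_topology_def by (simp only: topology_inverse')
qed

lemma topspace_quotient_topology:
  assumes "equiv (topspace X) r"
  shows "topspace (quotient_topology X r) = topspace X // r"
proof
  have "openin (quotient_topology X r) (topspace X // r)"
    unfolding openin_quotient_topology[OF assms] by (simp add: Union_quotient[OF assms])
  then show "topspace X // r \<subseteq> topspace (quotient_topology X r)"
    by (rule openin_subset)
qed (metis assms openin_quotient_topology openin_topspace)

lemma quotient_map_quotient_topology:
  assumes "equiv (topspace X) r"
  shows "quotient_map X (quotient_topology X r) (\<lambda>x. r `` {x})"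
  unfolding quotient_map_def topspace_quotient_topology[OF assms]
proof (intro conjI allI impI)
  show "(\<lambda>x. r `` {x}) ` topspace X = topspace X // r"
    by (auto simp: quotient_def)
  fix U assume U: "U \<subseteq> topspace X // r"
  have "{x \<in> topspace X. r `` {x} \<in> U} = \<Union>U"
  proof (intro equalityI subsetI)
    fix x assume "x \<in> {x \<in> topspace X. r `` {x} \<in> U}"
    then show "x \<in> \<Union>U" using equiv_class_self[OF assms] by blast
  next
    fix x assume "x \<in> \<Union>U"
    then obtain C where C: "C \<in> U" "x \<in> C" by blast
    then have "C \<in> topspace X // r" using U by blast
    then obtain y where y: "C = r `` {y}" by (auto elim: quotientE)
    then have yx: "(y, x) \<in> r" using C by auto
    then have "C = r `` {x}" using y equiv_class_eq[OF assms] by blast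
    moreover have "x \<in> topspace X" using yx equiv_type[OF assms] by blast
    ultimately have "C = r `` {x}" "x \<in> topspace X" by blast+
    then show "x \<in> {x \<in> topspace X. r `` {x} \<in> U}" using C by auto
  qed
  then show "openin X {x \<in> topspace X. r `` {x} \<in> U} = openin (quotient_topology X r) U"
    using U by (simp add: openin_quotient_topology[OF assms])
qed

lemma equiv_wedge_rel: "equiv (topspace (sum_topology X I)) (wedge_rel I X p)"
  by (rule equivI) (auto simp: wedge_rel_def refl_on_def sym_def trans_def)

lemma nsphere_base_in_nsphere: "nsphere_base \<in> topspace (nsphere k)"
  unfolding nsphere_base_def by (rule in_topspace_nsphere)

lemma four_dvd_wedge_count: "(4::nat) dvd (k + 1) * (k + 3) * (k + 4) * (k + 6)"
proof -
  have "(2::nat) dvd (k + 1) * (k + 6)" "(2::nat) dvd (k + 3) * (k + 4)" by simp_all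
  then have "2 * (2::nat) dvd ((k + 1) * (k + 6)) * ((k + 3) * (k + 4))" by (rule mult_dvd_mono)
  moreover have "((k + 1) * (k + 6)) * ((k + 3) * (k + 4)) = (k + 1) * (k + 3) * (k + 4) * (k + 6)"
    by (simp only: ac_simps)
  moreover have "2 * 2 = (4::nat)" by simp
  ultimately show ?thesis by (simp only:)
qed

end

theory Submission
  imports Defs
begin

text \<open>
  A family of 3-sets has a common neighbour iff its union has at most \<open>k + 3\<close> elements. Sending a
  family to its union therefore identifies the neighborhood complex, up to homotopy, with the order
  complex of the poset of subsets of \<open>{1..k + 6}\<close> whose size lies between 3 and \<open>k + 3\<close>.
  The maximal chains of this poset are shelled by the sum of all elements of all their members: in
  a chain \<open>A\<^sub>3 \<subset> \<dots> \<subset> A\<^bsub>k+3\<^esub>\<close> the set \<open>A\<^sub>i\<close> can be replaced by one of smaller sum iff some element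
  of \<open>A\<^bsub>i+1\<^esub> - A\<^sub>i\<close> is smaller than some element of \<open>A\<^sub>i - A\<^bsub>i-1\<^esub>\<close>. Collapsing all chains that do
  not descend at every step leaves a contractible subcomplex, to which the fully descending chains
  are attached as \<open>k\<close>-cells; hence the complex is a wedge of as many \<open>k\<close>-spheres, and these chains
  are determined by their first and last members.
\<close>

section \<open>Finite simplicial complexes\<close>

text \<open>Many maximal chains share the same sum, so the shelling is encoded by a potential
  instead of a linear order: distinct facets of equal potential never contain each other's
  restriction set, and no tie has to be broken. The comparison of complexes is done by explicit
  formulas in barycentric coordinates rather than by a nerve or fibre theorem; they are arranged so
  that each composite and the identity lie in a common simplex, where a straight line is a homotopy.
  The wedge is an honest quotient space, so the contractible part really has to be collapsed to a
  point: its contraction is extended over the cells, and each cell modulo its boundary is carried to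
  the sphere by a formula. For the count, the pairs of end members are sorted by the number r of
  ground elements above the maximum of the first member. Here r is 0, 1 or 2, with contributions
  C(k+5,2) C(k+2,2), C(k+4,2) (k+1) and C(k+3,2), whose sum is the number in the theorem.\<close>

definition simplicial_complex :: "'v set set \<Rightarrow> bool" where
  "simplicial_complex K \<longleftrightarrow> finite K \<and> (\<forall>S\<in>K. finite S \<and> S \<noteq> {}) \<and>
     (\<forall>S\<in>K. \<forall>T. T \<subseteq> S \<longrightarrow> T \<noteq> {} \<longrightarrow> T \<in> K)"

text \<open>For finite \<open>K\<close> the realization is this set with the topology of pointwise
  convergence, so all topology below takes place in subspaces of one function space.\<close>

definition underlying_set :: "'v set set \<Rightarrow> ('v \<Rightarrow> real) set" where
  "underlying_set K = (\<Union>S\<in>K. realized_simplex S)"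

definition support :: "('v \<Rightarrow> real) \<Rightarrow> 'v set" where
  "support x = {v. x v \<noteq> 0}"

lemma realized_simplex_nonneg: "x \<in> realized_simplex S \<Longrightarrow> 0 \<le> x v"
  by (auto simp: realized_simplex_def)

lemma underlying_set_nonneg: "x \<in> underlying_set K \<Longrightarrow> 0 \<le> x v"
  by (auto simp: underlying_set_def realized_simplex_nonneg)

lemma support_subset: "x \<in> realized_simplex S \<Longrightarrow> support x \<subseteq> S"
  by (auto simp: realized_simplex_def support_def)

text \<open>The coordinate sum only sees the support, so every finite set containing the support can
  serve as carrier.\<close>

lemma realized_simplex_cong_support:
  assumes "x \<in> realized_simplex S" "finite S" "support x \<subseteq> T" "finite T"
  shows "x \<in> realized_simplex T"
proof -
  have "sum x T = sum x (support x)"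
    using assms by (intro sum.mono_neutral_right) (auto simp: support_def)
  also have "\<dots> = sum x S"
    using assms support_subset[OF assms(1)]
    by (intro sum.mono_neutral_left) (auto simp: support_def)
  finally show ?thesis
    using assms by (auto simp: realized_simplex_def support_def)
qed

lemma realized_simplex_mono:
  assumes "T \<subseteq> S" "finite S"
  shows "realized_simplex T \<subseteq> realized_simplex S"
  using assms realized_simplex_cong_support support_subset finite_subset
  by (metis subset_trans subsetI)

lemma support_nonempty: "x \<in> realized_simplex S \<Longrightarrow> support x \<noteq> {}"
  using sum.neutral[of S x] by (fastforce simp: realized_simplex_def support_def)

lemma in_underlying_set_iff:
  assumes "simplicial_complex K"
  shows "x \<in> underlying_set K \<longleftrightarrow> support x \<in> K \<and> x \<in> realized_simplex (support x)"
proof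
  assume "x \<in> underlying_set K"
  then obtain S where S: "S \<in> K" "x \<in> realized_simplex S"
    by (auto simp: underlying_set_def)
  then have "finite S" "support x \<in> K"
    using assms support_subset[of x S] support_nonempty[of x S]
    unfolding simplicial_complex_def by blast+
  then show "support x \<in> K \<and> x \<in> realized_simplex (support x)"
    using S support_subset[of x S] realized_simplex_cong_support[of x S "support x"]
    by (auto intro: finite_subset)
qed (auto simp: underlying_set_def)

lemma support_in_complex:
  assumes "simplicial_complex K" "x \<in> underlying_set K"
  shows "support x \<in> K"
  using assms in_underlying_set_iff by blast

lemma closed_underlying_set: "finite K \<Longrightarrow> closed (underlying_set K)"
  unfolding underlying_set_def using closed_realized_simplex by blast

text \<open>In a finite sum of nonnegative terms each term is at most the total, so the simplex is a
  closed subset of a product of unit intervals.\<close>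

lemma compact_realized_simplex:
  assumes "finite S"
  shows "compact (realized_simplex (S :: 'v set))"
proof -
  have "compactin (product_topology (\<lambda>_::'v. euclideanreal) UNIV) (PiE UNIV (\<lambda>_. {0..1}))"
    by (simp add: compactin_PiE)
  then have "compact (PiE (UNIV :: 'v set) (\<lambda>_. {0..1::real}))"
    by (simp add: euclidean_product_topology)
  moreover have "realized_simplex S \<subseteq> PiE UNIV (\<lambda>_. {0..1})"
  proof
    fix x assume x: "x \<in> realized_simplex S"
    have "x v \<le> 1" for v
    proof (cases "v \<in> S")
      case True
      then have "x v \<le> sum x S"
        using assms x by (intro member_le_sum) (auto simp: realized_simplex_def)
      then show ?thesis using x by (simp add: realized_simplex_def)
    qed (use x in \<open>auto simp: realized_simplex_def\<close>)
    then show "x \<in> PiE UNIV (\<lambda>_. {0..1})"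
      using x by (auto simp: realized_simplex_def)
  qed
  ultimately show ?thesis
    using closed_realized_simplex by (metis compact_Int_closed inf.absorb_iff2)
qed

lemma continuous_map_into_function_space:
  fixes f :: "'a \<Rightarrow> 'v \<Rightarrow> real"
  shows "continuous_map Z (top_of_set U) f \<longleftrightarrow>
    f \<in> topspace Z \<rightarrow> U \<and> (\<forall>v. continuous_map Z euclideanreal (\<lambda>z. f z v))"
proof -
  have "continuous_map Z euclidean f \<longleftrightarrow> (\<forall>v. continuous_map Z euclideanreal (\<lambda>z. f z v))"
    using continuous_map_componentwise_UNIV[of Z "\<lambda>_. euclideanreal" f]
    by (simp only: euclidean_product_topology)
  then show ?thesis
    by (simp only: continuous_map_in_subtopology conj_commute)
qed

lemma continuous_on_coordinate [continuous_intros]: "continuous_on U (\<lambda>x :: 'v \<Rightarrow> real. x v)"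
  by (rule continuous_on_subset[OF continuous_on_product_coordinates]) simp

lemma realized_simplex_convex_combination:
  assumes "x \<in> realized_simplex S" "y \<in> realized_simplex S" "0 \<le> t" "t \<le> 1"
  shows "(\<lambda>v. (1 - t) * x v + t * y v) \<in> realized_simplex S"
  using assms
  by (auto simp: realized_simplex_def sum.distrib simp flip: sum_distrib_left)

text \<open>Simplices are convex, so the segment between two points of a common simplex stays in the
  complex. This supplies the homotopies in the comparison of complexes, in the collapses and in the
  contraction of a full simplex.\<close>

lemma homotopic_straight_line:
  fixes f g :: "'a \<Rightarrow> 'v \<Rightarrow> real"
  assumes f: "continuous_map Z (top_of_set (underlying_set K)) f"
    and g: "continuous_map Z (top_of_set (underlying_set K)) g"
    and near: "\<And>z. z \<in> topspace Z \<Longrightarrow> \<exists>S\<in>K. f z \<in> realized_simplex S \<and> g z \<in> realized_simplex S"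
  shows "homotopic_with (\<lambda>_. True) Z (top_of_set (underlying_set K)) f g"
proof -
  let ?h = "\<lambda>p v. (1 - fst p) * f (snd p) v + fst p * g (snd p) v"
  let ?ZI = "prod_topology (top_of_set {0..1}) Z"
  have t: "continuous_map ?ZI euclideanreal fst"
    by (metis continuous_map_fst continuous_map_in_subtopology)
  have snd: "continuous_map ?ZI euclideanreal (\<lambda>p. u (snd p))"
    if "continuous_map Z euclideanreal u" for u
    using continuous_map_compose[OF continuous_map_snd that] by (simp add: o_def)
  have fg: "continuous_map ?ZI euclideanreal (\<lambda>p. f (snd p) v)"
    "continuous_map ?ZI euclideanreal (\<lambda>p. g (snd p) v)" for v
    using f g unfolding continuous_map_into_function_space by (auto intro: snd)
  have "continuous_map ?ZI (top_of_set (underlying_set K)) ?h"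
    unfolding continuous_map_into_function_space
  proof (intro conjI allI)
    show "?h \<in> topspace ?ZI \<rightarrow> underlying_set K"
      using near realized_simplex_convex_combination by (fastforce simp: underlying_set_def)
    show "continuous_map ?ZI euclideanreal (\<lambda>z. ?h z v)" for v
      by (intro continuous_map_add continuous_map_real_mult continuous_map_diff t fg continuous_map_const[THEN iffD2]) auto
  qed
  then show ?thesis
    unfolding homotopic_with_def by (intro exI[of _ ?h]) auto
qed

section \<open>The complex of families with bounded union\<close>

definition order_complex :: "'a set set \<Rightarrow> 'a set set set" where
  "order_complex P = {c. c \<noteq> {} \<and> c \<subseteq> P \<and> (\<forall>A\<in>c. \<forall>B\<in>c. A \<subseteq> B \<or> B \<subseteq> A)}"

definition union_complex :: "'a set set \<Rightarrow> 'a set set \<Rightarrow> 'a set set set" where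
  "union_complex T P = {S. S \<noteq> {} \<and> S \<subseteq> T \<and> \<Union>S \<in> P}"

lemma simplicial_complex_order_complex: "finite P \<Longrightarrow> simplicial_complex (order_complex P)"
  unfolding simplicial_complex_def order_complex_def by (auto intro: finite_subset)

text \<open>\<open>T\<close> will be the 3-sets and \<open>P\<close> the sets of size 3 to k + 3.
  The axiom \<open>generated\<close> recovers a member of \<open>P\<close> from the generators below
  it; \<open>Union_closed\<close> makes the union complex closed under faces.\<close>

locale generated_family =
  fixes T P :: "'a set set"
  assumes finT: "finite T" and finP: "finite P"
    and finA: "\<And>A. A \<in> P \<Longrightarrow> finite A \<and> A \<noteq> {}"
    and generated: "\<And>A. A \<in> P \<Longrightarrow> \<Union>{B \<in> T. B \<subseteq> A} = A"
    and Union_closed: "\<And>A S. A \<in> P \<Longrightarrow> S \<subseteq> {B \<in> T. B \<subseteq> A} \<Longrightarrow> S \<noteq> {} \<Longrightarrow> \<Union>S \<in> P"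
begin

lemma simplicial_complex_union_complex: "simplicial_complex (union_complex T P)"
proof -
  have "V \<in> union_complex T P" if "S \<in> union_complex T P" "V \<subseteq> S" "V \<noteq> {}" for S V
    using that Union_closed[of "\<Union>S" V] unfolding union_complex_def by blast
  moreover have "finite (union_complex T P)"
    using finT by (auto simp: union_complex_def intro: finite_subset[of _ "Pow T"])
  moreover have "finite S \<and> S \<noteq> {}" if "S \<in> union_complex T P" for S
    using that finite_subset[of S T] finT unfolding union_complex_def by simp
  ultimately show ?thesis
    unfolding simplicial_complex_def by blast
qed

text \<open>The weight of \<^term>\<open>A\<close> is positive iff \<^term>\<open>A\<close> is the union of a superlevel set
  \<^term>\<open>{B \<in> T. s < x B}\<close> with \<^term>\<open>0 \<le> s\<close>; such unions form a chain.\<close>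

definition level_weight :: "('a set \<Rightarrow> real) \<Rightarrow> 'a set \<Rightarrow> real" where
  "level_weight x A = (if A \<in> P then
     \<Prod>a\<in>A. \<Sum>B\<in>{B\<in>T. a \<in> B}. x B * (\<Prod>C\<in>{C\<in>T. \<not> C \<subseteq> A}. max 0 (x B - x C)) else 0)"

definition to_order :: "('a set \<Rightarrow> real) \<Rightarrow> 'a set \<Rightarrow> real" where
  "to_order x A = level_weight x A / (\<Sum>A\<in>P. level_weight x A)"

definition gens_below :: "'a set \<Rightarrow> 'a set set" where
  "gens_below A = {B \<in> T. B \<subseteq> A}"

text \<open>The simplexwise affine map sending the vertex \<open>A\<close> to the barycentre of the
  simplex spanned by \<open>gens_below A\<close>.\<close>

definition from_order :: "('a set \<Rightarrow> real) \<Rightarrow> 'a set \<Rightarrow> real" where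
  "from_order y B = (\<Sum>A\<in>P. if B \<in> gens_below A then y A / real (card (gens_below A)) else 0)"

lemma level_weight_nonneg: "(\<And>B. 0 \<le> x B) \<Longrightarrow> 0 \<le> level_weight x A"
  unfolding level_weight_def by (auto intro!: prod_nonneg sum_nonneg mult_nonneg_nonneg)

text \<open>The formula mirrors the quantifiers: for nonnegative numbers a product is nonzero iff
  all factors are, a sum iff some term is, and \<open>max 0 (x B - x C)\<close> iff
  \<open>x C < x B\<close>. So a combinatorial condition becomes the nonvanishing of a continuous
  function.\<close>

lemma level_weight_nonzero_iff:
  assumes "\<And>B. 0 \<le> x B"
  shows "level_weight x A \<noteq> 0 \<longleftrightarrow> A \<in> P \<and>
     (\<forall>a\<in>A. \<exists>B\<in>T. a \<in> B \<and> x B > 0 \<and> (\<forall>C\<in>T. \<not> C \<subseteq> A \<longrightarrow> x C < x B))"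
proof -
  let ?p = "\<lambda>B. x B * (\<Prod>C\<in>{C\<in>T. \<not> C \<subseteq> A}. max 0 (x B - x C))"
  have p: "?p B \<noteq> 0 \<longleftrightarrow> x B > 0 \<and> (\<forall>C\<in>T. \<not> C \<subseteq> A \<longrightarrow> x C < x B)" for B
    using assms[of B] finT by (auto simp: max_def)
  have p0: "0 \<le> ?p B" for B
    using assms by (auto intro!: mult_nonneg_nonneg prod_nonneg)
  have s: "(\<Sum>B\<in>{B\<in>T. a \<in> B}. ?p B) \<noteq> 0 \<longleftrightarrow> (\<exists>B\<in>T. a \<in> B \<and> ?p B \<noteq> 0)" for a
    using finT p0 by (subst sum_nonneg_eq_0_iff) auto
  have "level_weight x A \<noteq> 0 \<longleftrightarrow> A \<in> P \<and> (\<forall>a\<in>A. (\<Sum>B\<in>{B\<in>T. a \<in> B}. ?p B) \<noteq> 0)"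
    using finA by (auto simp: level_weight_def)
  then show ?thesis
    unfolding s p .
qed

lemma level_weight_gens:
  assumes "\<And>B. 0 \<le> x B" "level_weight x A \<noteq> 0" "a \<in> A"
  shows "\<exists>B\<in>gens_below A. a \<in> B \<and> x B > 0 \<and> (\<forall>C\<in>T. \<not> C \<subseteq> A \<longrightarrow> x C < x B)"
proof -
  obtain B where "B \<in> T" "a \<in> B" "x B > 0" "\<forall>C\<in>T. \<not> C \<subseteq> A \<longrightarrow> x C < x B"
    using level_weight_nonzero_iff[of x A] assms by blast
  \<comment> \<open>Otherwise the choice \<open>C = B\<close> would give
    \<open>x B < x B\<close>.\<close>
  moreover from this have "B \<subseteq> A" by blast
  ultimately show ?thesis unfolding gens_below_def by blast
qed

text \<open>If neither set contained the other, a generator through a point of \<open>A - A'\<close>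
  would have to outweigh one through a point of \<open>A' - A\<close>, and conversely.\<close>

lemma level_weight_chain:
  assumes x: "\<And>B. 0 \<le> x B" and "level_weight x A \<noteq> 0" "level_weight x A' \<noteq> 0"
  shows "A \<subseteq> A' \<or> A' \<subseteq> A"
proof (rule ccontr)
  assume "\<not> (A \<subseteq> A' \<or> A' \<subseteq> A)"
  then obtain a b where a: "a \<in> A" "a \<notin> A'" and b: "b \<in> A'" "b \<notin> A" by blast
  obtain B where B: "B \<in> gens_below A" "a \<in> B" "\<forall>C\<in>T. \<not> C \<subseteq> A \<longrightarrow> x C < x B"
    using level_weight_gens[OF x assms(2) a(1)] by blast
  obtain C where C: "C \<in> gens_below A'" "b \<in> C" "\<forall>D\<in>T. \<not> D \<subseteq> A' \<longrightarrow> x D < x C"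
    using level_weight_gens[OF x assms(3) b(1)] by blast
  have "x C < x B" "x B < x C"
    using B C a b unfolding gens_below_def by blast+
  then show False by simp
qed

text \<open>This is the superlevel set at height 0: generators outside the union carry no mass. It
  makes the normalising sum in \<open>to_order\<close> positive.\<close>

lemma level_weight_Union_support:
  assumes x: "x \<in> underlying_set (union_complex T P)"
  shows "level_weight x (\<Union>(support x)) \<noteq> 0"
proof -
  have s: "support x \<in> union_complex T P"
    using support_in_complex[OF simplicial_complex_union_complex x] .
  have x0: "\<And>B. 0 \<le> x B"
    using x by (rule underlying_set_nonneg)
  have "\<exists>B\<in>T. a \<in> B \<and> x B > 0 \<and> (\<forall>C\<in>T. \<not> C \<subseteq> \<Union>(support x) \<longrightarrow> x C < x B)"
    if "a \<in> \<Union>(support x)" for a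
  proof -
    obtain B where B: "B \<in> support x" "a \<in> B" using \<open>a \<in> \<Union>(support x)\<close> by blast
    then have "x B > 0" using x0[of B] by (auto simp: support_def)
    moreover have "x C = 0" if "\<not> C \<subseteq> \<Union>(support x)" for C
      using that by (auto simp: support_def)
    ultimately show ?thesis using B s unfolding union_complex_def by (intro bexI[of _ B]) auto
  qed
  then show ?thesis
    using s level_weight_nonzero_iff[OF x0] by (auto simp: union_complex_def)
qed

lemma sum_level_weight_pos:
  assumes x: "x \<in> underlying_set (union_complex T P)"
  shows "0 < (\<Sum>A\<in>P. level_weight x A)"
proof -
  have x0: "\<And>B. 0 \<le> x B"
    using x by (rule underlying_set_nonneg)
  have "\<Union>(support x) \<in> P"
    using support_in_complex[OF simplicial_complex_union_complex x]
    by (simp add: union_complex_def)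
  then show ?thesis
    using finP level_weight_Union_support[OF x] level_weight_nonneg[of x, OF x0]
    by (intro sum_pos2[of P "\<Union>(support x)"]) (auto simp: order_less_le)
qed

lemma to_order_in:
  assumes x: "x \<in> underlying_set (union_complex T P)"
  shows "to_order x \<in> underlying_set (order_complex P)"
    and "support (to_order x) = {A. level_weight x A \<noteq> 0}"
proof -
  have x0: "\<And>B. 0 \<le> x B"
    using x by (rule underlying_set_nonneg)
  note pos = sum_level_weight_pos[OF x]
  show supp: "support (to_order x) = {A. level_weight x A \<noteq> 0}"
    using pos by (auto simp: support_def to_order_def)
  have sub: "{A. level_weight x A \<noteq> 0} \<subseteq> P"
    by (auto simp: level_weight_def split: if_splits)
  have "(\<Sum>A\<in>P. to_order x A) = 1"
    using pos by (simp add: to_order_def flip: sum_divide_distrib)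
  then have "to_order x \<in> realized_simplex P"
    using level_weight_nonneg[of x, OF x0] pos sub
    by (auto simp: realized_simplex_def to_order_def)
  then have "to_order x \<in> realized_simplex (support (to_order x))"
    using realized_simplex_cong_support finP sub supp finite_subset by (metis order_refl)
  moreover have "support (to_order x) \<in> order_complex P"
    using sub level_weight_chain[of x, OF x0] level_weight_Union_support[OF x]
    unfolding supp order_complex_def by blast
  ultimately show "to_order x \<in> underlying_set (order_complex P)"
    by (auto simp: underlying_set_def)
qed

lemma continuous_on_to_order: "continuous_on (underlying_set (union_complex T P)) to_order"
proof -
  have w: "continuous_on U (\<lambda>x. level_weight x A)" for A U
    unfolding level_weight_def
    by (cases "A \<in> P") (auto intro!: continuous_intros)
  show ?thesis
    unfolding to_order_def
    using sum_level_weight_pos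
    by (intro continuous_on_coordinatewise_then_product continuous_on_divide continuous_on_sum w) force
qed

lemma gens_below:
  assumes "A \<in> P"
  shows "finite (gens_below A)" "gens_below A \<noteq> {}" "gens_below A \<in> union_complex T P"
    "card (gens_below A) > 0"
proof -
  show fin: "finite (gens_below A)"
    using finT by (simp add: gens_below_def)
  show ne: "gens_below A \<noteq> {}"
    using finA[OF assms] generated[OF assms] unfolding gens_below_def by auto
  show "gens_below A \<in> union_complex T P"
    using assms ne generated[OF assms] by (auto simp: union_complex_def gens_below_def)
  show "card (gens_below A) > 0" using fin ne by auto
qed

lemma chain_has_max:
  assumes "c \<in> order_complex P"
  shows "\<exists>M\<in>c. \<forall>A\<in>c. A \<subseteq> M"
proof -
  have "finite c" "c \<noteq> {}" using assms finP by (auto simp: order_complex_def intro: finite_subset)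
  then obtain M where M: "M \<in> c" "\<forall>A\<in>c. M \<subseteq> A \<longrightarrow> M = A"
    using finite_has_maximal[of c] by auto
  have "A \<subseteq> M" if "A \<in> c" for A
  proof -
    have "A \<subseteq> M \<or> M \<subseteq> A" using assms M(1) that by (simp add: order_complex_def)
    then show ?thesis using M(2) that by auto
  qed
  then show ?thesis using M(1) by blast
qed

lemma chain_has_min:
  assumes "c \<in> order_complex P"
  shows "\<exists>M\<in>c. \<forall>A\<in>c. M \<subseteq> A"
proof -
  have "finite c" "c \<noteq> {}" using assms finP by (auto simp: order_complex_def intro: finite_subset)
  then obtain M where M: "M \<in> c" "\<forall>A\<in>c. A \<subseteq> M \<longrightarrow> M = A"
    using finite_has_minimal[of c] by auto
  have "M \<subseteq> A" if "A \<in> c" for A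
  proof -
    have "A \<subseteq> M \<or> M \<subseteq> A" using assms M(1) that by (simp add: order_complex_def)
    then show ?thesis using M(2) that by auto
  qed
  then show ?thesis using M(1) by blast
qed

text \<open>Generators of all chain members lie below the largest member, and mass is preserved
  because \<open>y A\<close> is split evenly over \<open>gens_below A\<close>.\<close>

lemma from_order_in_simplex:
  assumes y: "y \<in> realized_simplex c" and c: "c \<in> order_complex P"
    and M: "M \<in> c" "\<And>A. A \<in> c \<Longrightarrow> A \<subseteq> M"
  shows "from_order y \<in> realized_simplex (gens_below M)"
proof -
  have MP: "M \<in> P" and cP: "c \<subseteq> P" using M c by (auto simp: order_complex_def)
  have y0: "y A = 0" if "A \<notin> c" for A
    using y that by (auto simp: realized_simplex_def)
  have nonneg: "0 \<le> y A" for A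
    using y by (auto simp: realized_simplex_def)
  have sub: "gens_below A \<subseteq> gens_below M" if "A \<in> c" for A
    using M(2)[OF that] by (auto simp: gens_below_def)
  have "(\<Sum>B\<in>gens_below M. from_order y B) =
      (\<Sum>A\<in>P. \<Sum>B\<in>gens_below M. if B \<in> gens_below A then y A / real (card (gens_below A)) else 0)"
    unfolding from_order_def by (rule sum.swap)
  also have "\<dots> = (\<Sum>A\<in>P. y A)"
  proof (rule sum.cong[OF refl])
    fix A assume A: "A \<in> P"
    show "(\<Sum>B\<in>gens_below M. if B \<in> gens_below A then y A / real (card (gens_below A)) else 0) = y A"
    proof (cases "A \<in> c")
      case True
      then have "gens_below M \<inter> gens_below A = gens_below A" using sub by blast
      then show ?thesis
        using gens_below[OF MP] gens_below[OF A]
        by (simp add: sum.inter_restrict[symmetric])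
    qed (simp add: y0 cong: if_cong)
  qed
  also have "\<dots> = (\<Sum>A\<in>c. y A)"
    using finP cP y0 by (intro sum.mono_neutral_right) auto
  also have "\<dots> = 1"
    using y by (simp add: realized_simplex_def)
  finally have 1: "(\<Sum>B\<in>gens_below M. from_order y B) = 1" .
  have "from_order y B = 0" if "B \<notin> gens_below M" for B
    unfolding from_order_def using that sub y0 by (intro sum.neutral) auto
  moreover have "0 \<le> from_order y B" for B
    unfolding from_order_def using nonneg by (intro sum_nonneg) auto
  ultimately show ?thesis using 1 by (auto simp: realized_simplex_def)
qed

lemma continuous_on_from_order: "continuous_on U from_order"
proof -
  have "continuous_on U (\<lambda>y. if B \<in> gens_below A then y A / real (card (gens_below A)) else 0)"
    for A B
    by (cases "B \<in> gens_below A")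
       (simp_all add: divide_inverse continuous_on_mult_right continuous_on_coordinate)
  then show ?thesis
    unfolding from_order_def
    by (intro continuous_on_coordinatewise_then_product continuous_on_sum)
qed

text \<open>The value of \<open>from_order y\<close> at a generator depends only on which chain
  members contain it, so superlevel sets have chain members as unions. The proof takes the smallest
  chain member \<open>E\<close> containing \<open>A\<close> and shows \<open>A = E\<close>.\<close>

lemma support_to_from_order:
  assumes y: "y \<in> realized_simplex c" and c: "c \<in> order_complex P"
    and A: "level_weight (from_order y) A \<noteq> 0"
  shows "A \<in> c"
proof -
  have nonneg: "0 \<le> y A" for A
    using y by (auto simp: realized_simplex_def)
  have y0: "y A = 0" if "A \<notin> c" for A
    using y that by (auto simp: realized_simplex_def)
  obtain M where M: "M \<in> c" "\<And>A. A \<in> c \<Longrightarrow> A \<subseteq> M"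
    using chain_has_max[OF c] by blast
  have inM: "from_order y \<in> realized_simplex (gens_below M)"
    using from_order_in_simplex[OF y c M] .
  have g0: "\<And>B. 0 \<le> from_order y B" and gM: "\<And>B. B \<notin> gens_below M \<Longrightarrow> from_order y B = 0"
    using inM by (auto simp: realized_simplex_def)
  have AM: "A \<subseteq> M"
  proof
    fix a assume "a \<in> A"
    then obtain B where "a \<in> B" "from_order y B > 0"
      using level_weight_gens[OF g0 A] by blast
    then show "a \<in> M" using gM[of B] by (cases "B \<in> gens_below M") (auto simp: gens_below_def)
  qed
  let ?d = "{E \<in> c. A \<subseteq> E}"
  have "?d \<in> order_complex P" using c M(1) AM by (auto simp: order_complex_def)
  then obtain E where E: "E \<in> c" "A \<subseteq> E" and Emin: "\<And>F. F \<in> c \<Longrightarrow> A \<subseteq> F \<Longrightarrow> E \<subseteq> F"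
    using chain_has_min[of ?d] by blast
  have "A = E"
  proof (rule ccontr)
    assume "A \<noteq> E"
    then obtain b where b: "b \<in> E" "b \<notin> A" using E by blast
    have EP: "E \<in> P" using E c by (auto simp: order_complex_def)
    then obtain B where B: "B \<in> gens_below E" "b \<in> B"
      using b generated[OF EP] unfolding gens_below_def by blast
    \<comment> \<open>A point of \<open>A\<close> outside the largest chain member that does not
      contain \<open>A\<close> lies only in chain members containing all of
      \<open>A\<close>.\<close>
    let ?d = "{F \<in> c. \<not> A \<subseteq> F}"
    have "\<exists>a\<in>A. \<forall>F\<in>c. a \<in> F \<longrightarrow> A \<subseteq> F"
    proof (cases "?d = {}")
      case True
      moreover have "A \<in> P" using level_weight_nonzero_iff[of "from_order y" A] g0 A by simp
      ultimately show ?thesis using finA[of A] by auto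
    next
      case False
      then have "?d \<in> order_complex P" using c by (auto simp: order_complex_def)
      then obtain F where F: "F \<in> c" "\<not> A \<subseteq> F" and Fmax: "\<And>G. G \<in> c \<Longrightarrow> \<not> A \<subseteq> G \<Longrightarrow> G \<subseteq> F"
        using chain_has_max[of ?d] by auto
      then obtain a where "a \<in> A" "a \<notin> F" by blast
      then show ?thesis using Fmax by (intro bexI[of _ a]) auto
    qed
    then obtain a where a: "a \<in> A" "\<And>F. F \<in> c \<Longrightarrow> a \<in> F \<Longrightarrow> A \<subseteq> F" by blast
    obtain D where D: "D \<in> gens_below A" "a \<in> D"
      "\<forall>C\<in>T. \<not> C \<subseteq> A \<longrightarrow> from_order y C < from_order y D"
      using level_weight_gens[OF g0 A a(1)] by blast
    have "from_order y B < from_order y D"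
      using D(3) B b unfolding gens_below_def by blast
    \<comment> \<open>Every chain member containing \<open>D\<close> contains \<open>a\<close>,
      hence \<open>A\<close>, hence \<open>E\<close>, hence \<open>B\<close>; so \<open>B\<close>
      collects at least the terms of \<open>D\<close>.\<close>
    moreover have "from_order y D \<le> from_order y B"
      unfolding from_order_def
    proof (rule sum_mono)
      fix F assume F: "F \<in> P"
      show "(if D \<in> gens_below F then y F / real (card (gens_below F)) else 0)
        \<le> (if B \<in> gens_below F then y F / real (card (gens_below F)) else 0)"
      proof (cases "F \<in> c \<and> D \<in> gens_below F")
        case True
        then have "E \<subseteq> F" using a(2) D(2) Emin unfolding gens_below_def by blast
        then have "B \<in> gens_below F" using B unfolding gens_below_def by blast
        then show ?thesis using nonneg by auto
      qed (use y0 nonneg in auto)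
    qed
    ultimately show False by simp
  qed
  then show ?thesis using E by simp
qed

text \<open>Each composite shares a simplex with the identity: all generators below the union of the
  support of \<open>x\<close> in one case, any chain carrying \<open>y\<close> in the other.\<close>

theorem union_complex_homotopy_equivalent_order_complex:
  "top_of_set (underlying_set (union_complex T P)) homotopy_equivalent_space
   top_of_set (underlying_set (order_complex P))"
proof -
  let ?N = "underlying_set (union_complex T P)" and ?D = "underlying_set (order_complex P)"
  have f: "continuous_map (top_of_set ?N) (top_of_set ?D) to_order"
    using continuous_on_to_order to_order_in(1) by auto
  have gin: "from_order y \<in> ?N" if "y \<in> ?D" for y
  proof -
    obtain c where c: "c \<in> order_complex P" "y \<in> realized_simplex c"
      using \<open>y \<in> ?D\<close> by (auto simp: underlying_set_def)
    obtain M where M: "M \<in> c" "\<And>A. A \<in> c \<Longrightarrow> A \<subseteq> M"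
      using chain_has_max[OF c(1)] by blast
    moreover have "M \<in> P" using M c by (auto simp: order_complex_def)
    ultimately show ?thesis
      using from_order_in_simplex[OF c(2,1)] gens_below(3) unfolding underlying_set_def by blast
  qed
  have g: "continuous_map (top_of_set ?D) (top_of_set ?N) from_order"
    using continuous_on_from_order gin by auto
  have "homotopic_with (\<lambda>_. True) (top_of_set ?N) (top_of_set ?N) (from_order \<circ> to_order) id"
  proof (rule homotopic_straight_line)
    fix x assume "x \<in> topspace (top_of_set ?N)"
    then have x: "x \<in> ?N" by simp
    have x0: "\<And>B. 0 \<le> x B"
      using x by (rule underlying_set_nonneg)
    let ?U = "\<Union>(support x)"
    have s: "support x \<in> union_complex T P" "x \<in> realized_simplex (support x)"
      using x in_underlying_set_iff[OF simplicial_complex_union_complex] by auto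
    then have U: "?U \<in> P" "support x \<subseteq> gens_below ?U"
      by (auto simp: union_complex_def gens_below_def)
    note t = to_order_in[OF x]
    let ?c = "support (to_order x)"
    have c: "?c \<in> order_complex P" "to_order x \<in> realized_simplex ?c"
      using t(1) in_underlying_set_iff[OF simplicial_complex_order_complex[OF finP]] by auto
    have "A \<subseteq> ?U" if "A \<in> ?c" for A
    proof
      fix a assume "a \<in> A"
      moreover have "level_weight x A \<noteq> 0" using \<open>A \<in> ?c\<close> t(2) by simp
      ultimately obtain B where "a \<in> B" "x B > 0"
        using level_weight_gens[of x A a] x0 by blast
      then show "a \<in> ?U" by (force simp: support_def)
    qed
    moreover have "?U \<in> ?c" using level_weight_Union_support[OF x] t(2) by simp
    ultimately have "from_order (to_order x) \<in> realized_simplex (gens_below ?U)"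
      using from_order_in_simplex[OF c(2,1)] by blast
    moreover have "x \<in> realized_simplex (gens_below ?U)"
      using realized_simplex_mono[OF U(2) gens_below(1)[OF U(1)]] s by blast
    ultimately show "\<exists>S\<in>union_complex T P. (from_order \<circ> to_order) x \<in> realized_simplex S \<and> id x \<in> realized_simplex S"
      using gens_below(3)[OF U(1)] by auto
  qed (use continuous_map_compose[OF f g] in auto)
  moreover have "homotopic_with (\<lambda>_. True) (top_of_set ?D) (top_of_set ?D) (to_order \<circ> from_order) id"
  proof (rule homotopic_straight_line)
    fix y assume "y \<in> topspace (top_of_set ?D)"
    then obtain c where c: "c \<in> order_complex P" "y \<in> realized_simplex c"
      by (auto simp: underlying_set_def)
    then have yD: "y \<in> ?D" by (auto simp: underlying_set_def)
    note t = to_order_in[OF gin[OF yD]]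
    have finc: "finite c" using c finP by (auto simp: order_complex_def intro: finite_subset)
    let ?s = "support (to_order (from_order y))"
    have sc: "?s \<subseteq> c" using t(2) support_to_from_order[OF c(2,1)] by auto
    moreover have "to_order (from_order y) \<in> realized_simplex ?s"
      using t(1) in_underlying_set_iff[OF simplicial_complex_order_complex[OF finP]] by auto
    ultimately have "to_order (from_order y) \<in> realized_simplex c"
      using realized_simplex_mono[OF sc finc] by blast
    then show "\<exists>S\<in>order_complex P. (to_order \<circ> from_order) y \<in> realized_simplex S \<and> id y \<in> realized_simplex S"
      using c by auto
  qed (use continuous_map_compose[OF g f] in auto)
  ultimately show ?thesis
    unfolding homotopy_equivalent_space_def using f g by blast
qed

end

section \<open>Collapsing and shelling\<close>

lemma continuous_on_Min:
  fixes f :: "'i \<Rightarrow> 'a::topological_space \<Rightarrow> real"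
  assumes "finite I" "I \<noteq> {}" "\<And>i. i \<in> I \<Longrightarrow> continuous_on U (f i)"
  shows "continuous_on U (\<lambda>x. Min ((\<lambda>i. f i x) ` I))"
  using assms
proof (induction I rule: finite_ne_induct)
  case (insert i I)
  then have "Min ((\<lambda>j. f j x) ` insert i I) = min (f i x) (Min ((\<lambda>j. f j x) ` I))" for x
    by simp
  then show ?case
    using insert by (auto intro!: continuous_on_min)
qed simp

text \<open>The retraction of an elementary collapse: a point of the simplex \<open>F\<close> moves
  parallel to the line from the barycentre of \<open>R\<close> to that of \<open>F - R\<close> until
  some coordinate in \<open>R\<close> vanishes.\<close>

definition spread :: "'v set \<Rightarrow> 'v set \<Rightarrow> ('v \<Rightarrow> real) \<Rightarrow> 'v \<Rightarrow> real" where
  "spread R F x v = (if v \<in> R then x v - Min (x ` R)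
     else if v \<in> F then x v + Min (x ` R) * real (card R) / real (card (F - R)) else x v)"

lemma continuous_on_spread:
  assumes "finite R" "R \<noteq> {}"
  shows "continuous_on U (spread R F)"
proof (intro continuous_on_coordinatewise_then_product)
  fix v
  have "continuous_on U (\<lambda>x. Min (x ` R))"
    by (rule continuous_on_Min[OF assms, of U "\<lambda>v x. x v"]) (rule continuous_on_coordinate)
  then show "continuous_on U (\<lambda>x. spread R F x v)"
    unfolding spread_def
    by (cases "v \<in> R"; cases "v \<in> F")
       (auto simp: divide_inverse intro!: continuous_intros)
qed

lemma spread_in_simplex:
  assumes F: "finite F" and R: "R \<subset> F" "R \<noteq> {}" and x: "x \<in> realized_simplex F"
  shows "spread R F x \<in> realized_simplex F" and "\<exists>v\<in>R. spread R F x v = 0"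
proof -
  have finR: "finite R" using F R by (auto intro: finite_subset)
  have x0: "\<And>v. 0 \<le> x v" and xF: "\<And>v. v \<notin> F \<Longrightarrow> x v = 0" and x1: "sum x F = 1"
    using x by (auto simp: realized_simplex_def)
  have m0: "0 \<le> Min (x ` R)" using finR R x0 by simp
  have mR: "Min (x ` R) \<le> x v" if "v \<in> R" for v using finR that by simp
  have cd: "card (F - R) > 0" using F R by (auto simp: card_gt_0_iff)
  have "sum (spread R F x) F = sum (spread R F x) R + sum (spread R F x) (F - R)"
    using F R by (metis add.commute psubset_imp_subset sum.subset_diff)
  also have "sum (spread R F x) R = sum x R - real (card R) * Min (x ` R)"
    by (simp add: spread_def sum_subtractf)
  also have "sum (spread R F x) (F - R) =
      sum (\<lambda>v. x v + Min (x ` R) * real (card R) / real (card (F - R))) (F - R)"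
    by (rule sum.cong) (auto simp: spread_def)
  also have "\<dots> = sum x (F - R) + Min (x ` R) * real (card R)"
    using cd by (simp add: sum.distrib)
  finally have "sum (spread R F x) F = sum x R + sum x (F - R)" by simp
  also have "\<dots> = 1"
    using F R x1 by (metis add.commute psubset_imp_subset sum.subset_diff)
  finally show "spread R F x \<in> realized_simplex F"
    using m0 mR x0 xF R by (auto simp: realized_simplex_def spread_def)
  have "Min (x ` R) \<in> x ` R" using finR R by simp
  then show "\<exists>v\<in>R. spread R F x v = 0" by (auto simp: spread_def)
qed

lemma spread_fixed:
  assumes "finite R" "\<And>u. 0 \<le> x u" "v \<in> R" "x v = 0"
  shows "spread R F x = x"
proof -
  have "Min (x ` R) = 0" using assms by (intro Min_eqI) auto
  then show ?thesis by (auto simp: spread_def)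
qed

text \<open>The new faces form the interval between \<open>R\<close> and \<open>F\<close>, and
  \<open>spread\<close> retracts them onto the faces missing a vertex of \<open>R\<close>. Since
  \<open>R\<close> is proper, the removed mass has somewhere to go.\<close>

lemma collapse_homotopy_equivalent:
  assumes K: "simplicial_complex K" and K': "simplicial_complex K'"
    and KK': "K' = K \<union> {c. c \<subseteq> F \<and> c \<noteq> {}}"
    and F: "finite F" and R: "R \<subset> F" "R \<noteq> {}"
    and faces: "\<And>c. c \<subseteq> F \<Longrightarrow> c \<noteq> {} \<Longrightarrow> c \<in> K \<longleftrightarrow> \<not> R \<subseteq> c"
  shows "top_of_set (underlying_set K') homotopy_equivalent_space top_of_set (underlying_set K)"
proof -
  define r where "r x = (if x \<in> underlying_set K then x else spread R F x)" for x
  have finR: "finite R" using F R by (auto intro: finite_subset)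
  have FK': "F \<in> K'" using KK' R by auto
  have eq: "underlying_set K' = underlying_set K \<union> realized_simplex F"
  proof
    show "underlying_set K' \<subseteq> underlying_set K \<union> realized_simplex F"
      unfolding underlying_set_def KK' using realized_simplex_mono[OF _ F] by auto
    show "underlying_set K \<union> realized_simplex F \<subseteq> underlying_set K'"
      unfolding underlying_set_def using FK' KK' by auto
  qed
  \<comment> \<open>On the overlap some coordinate in \<open>R\<close> is already 0, so the two
    branches of \<open>r\<close> agree there.\<close>
  have fixed: "spread R F x = x" if x: "x \<in> underlying_set K" "x \<in> realized_simplex F" for x
  proof -
    have "support x \<in> K" "support x \<subseteq> F" "support x \<noteq> {}"
      using support_in_complex[OF K x(1)] support_subset[OF x(2)] support_nonempty[OF x(2)] by auto
    then obtain v where "v \<in> R" "x v = 0" using faces[of "support x"] by (auto simp: support_def)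
    then show ?thesis
      using spread_fixed[OF finR] realized_simplex_nonneg[OF x(2)] by blast
  qed
  have cont: "continuous_on (underlying_set K') r"
    unfolding r_def eq
    using K closed_underlying_set closed_realized_simplex continuous_on_spread[OF finR R(2)] fixed
    by (intro continuous_on_If) (auto simp: simplicial_complex_def)
  have spread_in: "spread R F x \<in> underlying_set K" if x: "x \<in> realized_simplex F" for x
  proof -
    note s = spread_in_simplex[OF F R x]
    have "support (spread R F x) \<subseteq> F" "support (spread R F x) \<noteq> {}"
      using support_subset[OF s(1)] support_nonempty[OF s(1)] by auto
    moreover have "\<not> R \<subseteq> support (spread R F x)" using s(2) by (auto simp: support_def)
    ultimately show ?thesis
      using faces realized_simplex_cong_support[OF s(1) F order_refl] F
      by (auto simp: in_underlying_set_iff[OF K] intro: finite_subset)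
  qed
  have r: "continuous_map (top_of_set (underlying_set K')) (top_of_set (underlying_set K)) r"
    using cont spread_in by (auto simp: r_def eq)
  have i: "continuous_map (top_of_set (underlying_set K)) (top_of_set (underlying_set K')) id"
    by (auto simp: eq)
  have "homotopic_with (\<lambda>_. True) (top_of_set (underlying_set K')) (top_of_set (underlying_set K')) (id \<circ> r) id"
  proof (rule homotopic_straight_line)
    fix x assume "x \<in> topspace (top_of_set (underlying_set K'))"
    then have "x \<in> underlying_set K \<or> x \<notin> underlying_set K \<and> x \<in> realized_simplex F"
      by (auto simp: eq)
    then show "\<exists>S\<in>K'. (id \<circ> r) x \<in> realized_simplex S \<and> id x \<in> realized_simplex S"
    proof
      assume "x \<in> underlying_set K"
      then show ?thesis by (auto simp: r_def underlying_set_def KK')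
    next
      assume "x \<notin> underlying_set K \<and> x \<in> realized_simplex F"
      then show ?thesis using spread_in_simplex(1)[OF F R, of x] FK' by (auto simp: r_def)
    qed
  qed (use continuous_map_compose[OF r i] in auto)
  moreover have "homotopic_with (\<lambda>_. True) (top_of_set (underlying_set K)) (top_of_set (underlying_set K)) (r \<circ> id) id"
    using continuous_map_compose[OF i r] by (intro homotopic_with_equal) (auto simp: r_def)
  ultimately show ?thesis
    unfolding homotopy_equivalent_space_def using r i by blast
qed

lemma contractible_full_simplex:
  assumes "finite F" "F \<noteq> {}"
  shows "contractible_space (top_of_set (underlying_set {c. c \<subseteq> F \<and> c \<noteq> {}}))"
proof -
  let ?K = "{c. c \<subseteq> F \<and> c \<noteq> {}}"
  obtain v where v: "v \<in> F" using assms by blast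
  define e where "e = (\<lambda>u. if u = v then 1 else (0::real))"
  have e: "e \<in> realized_simplex F" using assms v by (auto simp: e_def realized_simplex_def)
  have "F \<in> ?K" using assms by auto
  have "homotopic_with (\<lambda>_. True) (top_of_set (underlying_set ?K)) (top_of_set (underlying_set ?K)) id (\<lambda>_. e)"
  proof (rule homotopic_straight_line)
    fix x assume "x \<in> topspace (top_of_set (underlying_set ?K))"
    then have "x \<in> realized_simplex F"
      using realized_simplex_mono[OF _ assms(1)] by (auto simp: underlying_set_def)
    then show "\<exists>S\<in>?K. id x \<in> realized_simplex S \<and> e \<in> realized_simplex S"
      using e \<open>F \<in> ?K\<close> by auto
  qed (use e \<open>F \<in> ?K\<close> in \<open>auto simp: underlying_set_def\<close>)
  then show ?thesis unfolding contractible_space_def by blast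
qed

text \<open>Facets are added by increasing \<open>\<Psi>\<close>. By \<open>descend\<close>, a face
  of \<open>F\<close> missing a vertex of \<open>R F\<close> already occurs in a facet of lower
  potential; by \<open>restriction\<close>, a face containing \<open>R F\<close> occurs in no other
  facet of the same or lower potential. So \<open>R F\<close> is the restriction of \<open>F\<close>
  in the usual sense of shellings.\<close>

locale potential_shelling =
  fixes \<F> :: "'v set set" and R :: "'v set \<Rightarrow> 'v set" and \<Psi> :: "'v set \<Rightarrow> nat" and k :: nat
  assumes fin: "finite \<F>" and ne: "\<F> \<noteq> {}"
    and card_facet: "\<And>F. F \<in> \<F> \<Longrightarrow> card F = Suc k"
    and R_subset: "\<And>F. F \<in> \<F> \<Longrightarrow> R F \<subseteq> F"
    and descend: "\<And>F v. F \<in> \<F> \<Longrightarrow> v \<in> R F \<Longrightarrow> \<exists>F'\<in>\<F>. \<Psi> F' < \<Psi> F \<and> F - {v} \<subseteq> F'"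
    and restriction: "\<And>F F'. F \<in> \<F> \<Longrightarrow> F' \<in> \<F> \<Longrightarrow> R F \<subseteq> F' \<Longrightarrow> F' \<noteq> F \<Longrightarrow> \<Psi> F < \<Psi> F'"
begin

definition faces :: "'v set set \<Rightarrow> 'v set set" where
  "faces J = {c. c \<noteq> {} \<and> (\<exists>F\<in>J. c \<subseteq> F)}"

text \<open>The homology facets of the shelling: the whole boundary of such a facet is present
  before the facet is added.\<close>

definition critical :: "'v set set" where
  "critical = {F \<in> \<F>. R F = F}"

lemma finite_facet: "F \<in> \<F> \<Longrightarrow> finite F"
  using card_facet card.infinite by fastforce

lemma facet_nonempty: "F \<in> \<F> \<Longrightarrow> F \<noteq> {}"
  using card_facet by fastforce

lemma subset_facet_eq: "F \<in> \<F> \<Longrightarrow> F' \<in> \<F> \<Longrightarrow> F \<subseteq> F' \<Longrightarrow> F = F'"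
  using card_facet finite_facet by (simp add: card_subset_eq)

lemma simplicial_complex_faces:
  assumes "J \<subseteq> \<F>"
  shows "simplicial_complex (faces J)" "simplicial_complex (faces J - critical)"
proof -
  have "finite (\<Union>J)" using assms finite_subset[OF assms fin] finite_facet by (intro finite_Union) auto
  then have "finite (Pow (\<Union>J))" by simp
  then have 1: "finite (faces J)" by (rule rev_finite_subset) (auto simp: faces_def)
  have 2: "finite c \<and> c \<noteq> {}" if "c \<in> faces J" for c
    using that assms finite_facet finite_subset[of c] unfolding faces_def by blast
  have 3: "d \<in> faces J" if "c \<in> faces J" "d \<subseteq> c" "d \<noteq> {}" for c d
    using that unfolding faces_def by blast
  \<comment> \<open>Facets have equal cardinality, so a critical facet is a proper face of no
    simplex and can be removed.\<close>
  have 4: "d \<notin> critical" if c: "c \<in> faces J" "c \<notin> critical" and d: "d \<subseteq> c" for c d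
  proof
    assume d': "d \<in> critical"
    obtain F where F: "F \<in> J" "c \<subseteq> F" using c(1) by (auto simp: faces_def)
    then have "d = F" using subset_facet_eq[of d F] d d' assms by (auto simp: critical_def)
    then show False using F d d' c by auto
  qed
  show "simplicial_complex (faces J)"
    unfolding simplicial_complex_def by (intro conjI ballI allI impI 1) (use 2 in simp, use 2 in simp, use 3 in blast)
  show "simplicial_complex (faces J - critical)"
    unfolding simplicial_complex_def
    by (intro conjI ballI allI impI finite_Diff 1) (use 2 in simp, use 2 in simp, use 3 4 in blast)
qed

text \<open>Induction on the number of facets, deleting a facet \<open>F\<close> of maximal
  potential, which keeps the family closed under lower potential. The faces new with
  \<open>F\<close> are those containing \<open>R F\<close>: just \<open>F\<close> itself if it is
  critical, otherwise a collapsible interval.\<close>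

lemma contractible_downset:
  assumes "J \<subseteq> \<F>" "J \<noteq> {}" "\<And>F F'. F \<in> J \<Longrightarrow> F' \<in> \<F> \<Longrightarrow> \<Psi> F' < \<Psi> F \<Longrightarrow> F' \<in> J"
  shows "contractible_space (top_of_set (underlying_set (faces J - critical)))"
  using assms
proof (induction "card J" arbitrary: J)
  case 0
  then show ?case using fin by (simp add: finite_subset)
next
  case (Suc n)
  have finJ: "finite J" using Suc.prems fin finite_subset by blast
  obtain F where F: "F \<in> J" and max: "\<And>F'. F' \<in> J \<Longrightarrow> \<Psi> F' \<le> \<Psi> F"
  proof -
    have "Max (\<Psi> ` J) \<in> \<Psi> ` J" using finJ Suc.prems by simp
    then obtain F where "F \<in> J" "Max (\<Psi> ` J) = \<Psi> F" by auto
    then show ?thesis using that finJ by (metis Max_ge finite_imageI imageI)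
  qed
  have FF: "F \<in> \<F>" using F Suc.prems by auto
  let ?J = "J - {F}"
  have J'F: "?J \<subseteq> \<F>" using Suc.prems by auto
  have below: "F' \<in> ?J" if "F' \<in> \<F>" "\<Psi> F' < \<Psi> F" for F'
    using that Suc.prems(3)[OF F] by auto
  have notcrit: "c \<notin> critical" if "c \<subset> F" for c
    using that subset_facet_eq[of c F] FF by (auto simp: critical_def)
  have old: "c \<in> faces ?J" if "c \<subseteq> F" "c \<noteq> {}" "\<not> R F \<subseteq> c" for c
  proof -
    obtain v where v: "v \<in> R F" "v \<notin> c" using \<open>\<not> R F \<subseteq> c\<close> by blast
    then obtain F' where "F' \<in> \<F>" "\<Psi> F' < \<Psi> F" "F - {v} \<subseteq> F'" using descend[OF FF] by blast
    then have "F' \<in> ?J" "c \<subseteq> F'" using below v that by auto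
    then show ?thesis using that unfolding faces_def by blast
  qed
  have new: "c \<notin> faces ?J" if "R F \<subseteq> c" for c
  proof
    assume "c \<in> faces ?J"
    then obtain F' where F': "F' \<in> ?J" "c \<subseteq> F'" by (auto simp: faces_def)
    then have "\<Psi> F < \<Psi> F'" using restriction[OF FF, of F'] that J'F by auto
    then show False using max[of F'] F' by auto
  qed
  have facesJ: "faces J = faces ?J \<union> {c. c \<subseteq> F \<and> c \<noteq> {}}"
    using F by (auto simp: faces_def)
  show ?case
  proof (cases "?J = {}")
    case True
    then have J: "J = {F}" using F by auto
    \<comment> \<open>A vertex in \<open>R F\<close> would produce a second facet of
      \<open>J\<close>.\<close>
    have "R F = {}" using descend[OF FF] below True by blast
    then have "F \<notin> critical" using facet_nonempty[OF FF] by (auto simp: critical_def)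
    then have "faces J - critical = {c. c \<subseteq> F \<and> c \<noteq> {}}"
      using notcrit J by (auto simp: faces_def)
    then show ?thesis using contractible_full_simplex[OF finite_facet[OF FF] facet_nonempty[OF FF]] by simp
  next
    case False
    have IH: "contractible_space (top_of_set (underlying_set (faces ?J - critical)))"
    proof (rule Suc.hyps(1))
      show "n = card ?J" using Suc.hyps(2) F finJ by simp
      show "F'' \<in> ?J" if "F' \<in> ?J" "F'' \<in> \<F>" "\<Psi> F'' < \<Psi> F'" for F' F''
        using Suc.prems(3)[of F' F''] max[of F'] that by auto
    qed (use False J'F in auto)
    show ?thesis
    proof (cases "F \<in> critical")
      case True
      \<comment> \<open>Here \<open>R F = F\<close>, so \<open>F\<close> is the only new face, and
        it is removed.\<close>
      have "faces J - critical = faces ?J - critical"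
      proof -
        have "c \<in> faces ?J" if "c \<subseteq> F" "c \<noteq> {}" "c \<notin> critical" for c
        proof -
          have "c \<noteq> F" using True that by auto
          then show ?thesis using True old[of c] that by (auto simp: critical_def)
        qed
        then show ?thesis unfolding facesJ by blast
      qed
      then show ?thesis using IH by simp
    next
      case nc: False
      have R1: "R F \<subset> F" using nc R_subset[OF FF] FF by (auto simp: critical_def)
      \<comment> \<open>If \<open>R F\<close> were empty, every face of the remaining facets would
        contain it, against \<open>new\<close>.\<close>
      have R2: "R F \<noteq> {}" proof -
        obtain F' where "F' \<in> ?J" using False by blast
        then have "F' \<in> faces ?J" using facet_nonempty[of F'] J'F by (auto simp: faces_def)
        then show ?thesis using new[of F'] by auto
      qed
      have ncF: "c \<notin> critical" if "c \<subseteq> F" for c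
        using notcrit[of c] nc that by blast
      have "top_of_set (underlying_set (faces J - critical)) homotopy_equivalent_space
            top_of_set (underlying_set (faces ?J - critical))"
      proof (rule collapse_homotopy_equivalent[where F = F and R = "R F"])
        show "faces J - critical = faces ?J - critical \<union> {c. c \<subseteq> F \<and> c \<noteq> {}}"
          unfolding facesJ using ncF by auto
        show "c \<in> faces ?J - critical \<longleftrightarrow> \<not> R F \<subseteq> c" if "c \<subseteq> F" "c \<noteq> {}" for c
          using that old new ncF by blast
      qed (use simplicial_complex_faces[OF J'F] simplicial_complex_faces[OF Suc.prems(1)]
            finite_facet[OF FF] R1 R2 in auto)
      then show ?thesis using IH homotopy_equivalent_space_contractibility by blast
    qed
  qed
qed

lemma contractible_faces_minus_critical:
  "contractible_space (top_of_set (underlying_set (faces \<F> - critical)))"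
  using contractible_downset[of \<F>] ne by blast

text \<open>A facet of least potential has empty restriction set and therefore survives; a point of
  the contractible part is needed to hit the wedge point.\<close>

lemma noncritical_nonempty: "faces \<F> - critical \<noteq> {}"
proof -
  have "Min (\<Psi> ` \<F>) \<in> \<Psi> ` \<F>" using fin ne by simp
  then obtain F where F: "F \<in> \<F>" "\<Psi> F = Min (\<Psi> ` \<F>)" by auto
  have "R F = {}"
  proof (rule ccontr)
    assume "R F \<noteq> {}"
    then obtain F' where "F' \<in> \<F>" "\<Psi> F' < \<Psi> F" using descend[OF F(1)] by blast
    then show False using F fin by (metis Min_le finite_imageI imageI not_le)
  qed
  then have "F \<in> faces \<F> - critical"
    using F facet_nonempty[of F] by (auto simp: faces_def critical_def)
  then show ?thesis by blast
qed

end

section \<open>Collapsing the boundary of a simplex to a point\<close>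

lemma nsphere_eq_top_of_set:
  "nsphere k = top_of_set {x. (\<Sum>i\<le>k. x i ^ 2) = 1 \<and> (\<forall>i>k. x i = 0)}"
  unfolding nsphere by (simp only: euclidean_product_topology)

lemma Hausdorff_nsphere: "Hausdorff_space (nsphere k)"
  unfolding nsphere_def by (intro Hausdorff_space_subtopology Hausdorff_Euclidean_space)

locale enumerated_simplex =
  fixes e :: "nat \<Rightarrow> 'v" and F :: "'v set" and k :: nat
  assumes bij: "bij_betw e {..k} F"
begin

lemma F_eq: "F = e ` {..k}" and inj: "inj_on e {..k}"
  using bij by (auto simp: bij_betw_def)

lemma finF: "finite F" and neF: "F \<noteq> {}"
  by (auto simp: F_eq)

lemma e_in: "i \<le> k \<Longrightarrow> e i \<in> F"
  by (auto simp: F_eq)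

lemma sum_F: "sum x F = (\<Sum>i\<le>k. x (e i))"
  using inj by (simp add: F_eq sum.reindex)

text \<open>The inverse stereographic image of \<^term>\<open>\<lambda>i. (x (e i) - x (e 0)) / Min (x ` F)\<close>,
  written so that it also makes sense on the boundary, where the minimum vanishes.\<close>

definition sqdist :: "('v \<Rightarrow> real) \<Rightarrow> real" where
  "sqdist x = (\<Sum>i=1..k. (x (e i) - x (e 0))\<^sup>2)"

definition sphere_map :: "('v \<Rightarrow> real) \<Rightarrow> nat \<Rightarrow> real" where
  "sphere_map x i = (if i = 0 then (sqdist x - (Min (x ` F))\<^sup>2) / (sqdist x + (Min (x ` F))\<^sup>2)
     else if i \<le> k then 2 * Min (x ` F) * (x (e i) - x (e 0)) / (sqdist x + (Min (x ` F))\<^sup>2) else 0)"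

lemma sqdist_nonneg: "0 \<le> sqdist x"
  by (auto simp: sqdist_def intro: sum_nonneg)

lemma Min_le_coordinate: "v \<in> F \<Longrightarrow> Min (x ` F) \<le> x v" for x :: "'v \<Rightarrow> real"
  using finF by simp

lemma Min_attained: "\<exists>v\<in>F. x v = Min (x ` F)" for x :: "'v \<Rightarrow> real"
proof -
  have "Min (x ` F) \<in> x ` F" using finF neF by simp
  then show ?thesis by force
qed

lemma Min_nonneg: "x \<in> realized_simplex F \<Longrightarrow> 0 \<le> Min (x ` F)"
  using finF neF by (simp add: realized_simplex_nonneg)

text \<open>Both summands vanish only if all coordinates are equal with minimum 0, which contradicts
  total mass 1.\<close>

lemma denominator_pos:
  assumes "x \<in> realized_simplex F"
  shows "0 < sqdist x + (Min (x ` F))\<^sup>2"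
proof (rule ccontr)
  assume "\<not> ?thesis"
  then have s0: "sqdist x = 0" and m0: "Min (x ` F) = 0"
    using sqdist_nonneg[of x] zero_le_power2[of "Min (x ` F)"]
    by (smt (verit) zero_eq_power2)+
  have eq: "x (e i) = x (e 0)" if "i \<le> k" for i
  proof (cases "i = 0")
    case False
    then show ?thesis
      using s0 that unfolding sqdist_def by (subst (asm) sum_nonneg_eq_0_iff) auto
  qed simp
  obtain i where "i \<le> k" "x (e i) = 0" using Min_attained[of x] m0 by (auto simp: F_eq)
  then have "x (e 0) = 0" using eq[of i] by simp
  then have "x (e j) = 0" if "j \<le> k" for j using eq[OF that] by simp
  then have "sum x F = 0" unfolding sum_F by (intro sum.neutral) simp
  then show False using assms by (simp add: realized_simplex_def)
qed

lemma continuous_on_sphere_map: "continuous_on (realized_simplex F) sphere_map"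
proof (rule continuous_on_coordinatewise_then_product)
  fix i
  have m: "continuous_on (realized_simplex F) (\<lambda>x. Min (x ` F))"
    by (rule continuous_on_Min[OF finF neF, of _ "\<lambda>v x. x v"]) (rule continuous_on_coordinate)
  have s: "continuous_on (realized_simplex F) sqdist"
    unfolding sqdist_def by (intro continuous_intros)
  have "sqdist x + (Min (x ` F))\<^sup>2 \<noteq> 0" if "x \<in> realized_simplex F" for x
    using denominator_pos[OF that] by simp
  then show "continuous_on (realized_simplex F) (\<lambda>x. sphere_map x i)"
    unfolding sphere_map_def
    by (cases "i = 0"; cases "i \<le> k") (auto intro!: continuous_intros m s)
qed

lemma sum_split: "(\<Sum>i\<le>k. f i) = f 0 + (\<Sum>i=1..k. f i)" for f :: "nat \<Rightarrow> real"
  by (simp add: sum.atLeast_Suc_atMost atMost_atLeast0)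

lemma sphere_map_in_nsphere:
  assumes "x \<in> realized_simplex F"
  shows "sphere_map x \<in> topspace (nsphere k)"
proof -
  let ?m = "Min (x ` F)" and ?D = "sqdist x"
  note pos = denominator_pos[OF assms]
  have "(\<Sum>i=1..k. (sphere_map x i)\<^sup>2) = (\<Sum>i=1..k. (2 * ?m / (?D + ?m\<^sup>2))\<^sup>2 * (x (e i) - x (e 0))\<^sup>2)"
    by (rule sum.cong) (auto simp: sphere_map_def power_mult_distrib power_divide)
  also have "\<dots> = (2 * ?m / (?D + ?m\<^sup>2))\<^sup>2 * ?D"
    by (simp add: sqdist_def sum_distrib_left)
  finally have "(\<Sum>i\<le>k. (sphere_map x i)\<^sup>2) = ((?D - ?m\<^sup>2) / (?D + ?m\<^sup>2))\<^sup>2 + (2 * ?m / (?D + ?m\<^sup>2))\<^sup>2 * ?D"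
    by (simp add: sum_split sphere_map_def)
  also have "\<dots> = ((?D - ?m\<^sup>2)\<^sup>2 + (2 * ?m)\<^sup>2 * ?D) / (?D + ?m\<^sup>2)\<^sup>2"
    by (simp add: power_divide add_divide_distrib)
  also have "(?D - ?m\<^sup>2)\<^sup>2 + (2 * ?m)\<^sup>2 * ?D = (?D + ?m\<^sup>2)\<^sup>2"
    by (simp add: power2_eq_square algebra_simps)
  finally have "(\<Sum>i\<le>k. (sphere_map x i)\<^sup>2) = 1" using pos by simp
  then show ?thesis
    by (auto simp: nsphere_eq_top_of_set sphere_map_def)
qed

text \<open>The base point is the projection centre, and it receives exactly the boundary of the
  simplex.\<close>

lemma sphere_map_base_iff:
  assumes "x \<in> realized_simplex F"
  shows "sphere_map x = nsphere_base \<longleftrightarrow> Min (x ` F) = 0"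
proof
  assume "sphere_map x = nsphere_base"
  then have "sphere_map x 0 = 1" by (simp add: nsphere_base_def)
  then show "Min (x ` F) = 0"
    using denominator_pos[OF assms] by (simp add: sphere_map_def divide_eq_1_iff)
next
  assume "Min (x ` F) = 0"
  then show "sphere_map x = nsphere_base"
    using denominator_pos[OF assms] by (auto simp: sphere_map_def nsphere_base_def)
qed

text \<open>Stereographic projection from the base point undoes the map on the interior.\<close>

lemma sphere_map_ratio:
  assumes "x \<in> realized_simplex F" "Min (x ` F) \<noteq> 0" "i \<le> k"
  shows "(x (e i) - x (e 0)) / Min (x ` F) = (if i = 0 then 0 else sphere_map x i / (1 - sphere_map x 0))"
proof (cases "i = 0")
  case False
  let ?m = "Min (x ` F)" and ?D = "sqdist x"
  note pos = denominator_pos[OF assms(1)]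
  have "1 - sphere_map x 0 = 2 * ?m\<^sup>2 / (?D + ?m\<^sup>2)"
    using pos by (simp add: sphere_map_def field_simps)
  then show ?thesis
    using False assms pos by (simp add: sphere_map_def power2_eq_square)
qed simp

text \<open>Equal ratios mean that \<open>x\<close> and \<open>y\<close>, each divided by its
  minimum, differ by a constant \<open>\<delta>\<close>. Both rescaled points have minimum 1, so
  \<open>\<delta> = 0\<close>; total mass 1 then fixes the scale.\<close>

lemma sphere_map_inj:
  assumes x: "x \<in> realized_simplex F" "Min (x ` F) \<noteq> 0"
    and y: "y \<in> realized_simplex F" "Min (y ` F) \<noteq> 0"
    and eq: "sphere_map x = sphere_map y"
  shows "x = y"
proof -
  let ?m = "Min (x ` F)" and ?n = "Min (y ` F)"
  have pos: "?m > 0" "?n > 0" using x y Min_nonneg[of x] Min_nonneg[of y] by auto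
  define \<delta> where "\<delta> = x (e 0) / ?m - y (e 0) / ?n"
  have diff: "x v / ?m = y v / ?n + \<delta>" if "v \<in> F" for v
  proof -
    obtain i where i: "i \<le> k" "v = e i" using \<open>v \<in> F\<close> by (auto simp: F_eq)
    have "(x (e i) - x (e 0)) / ?m = (y (e i) - y (e 0)) / ?n"
      using sphere_map_ratio[OF x i(1)] sphere_map_ratio[OF y i(1)] eq by simp
    then show ?thesis by (simp add: \<delta>_def i diff_divide_distrib)
  qed
  obtain v where v: "v \<in> F" "x v = ?m" using Min_attained[of x] by blast
  have "1 = y v / ?n + \<delta>" using diff[OF v(1)] v pos by simp
  moreover have "1 \<le> y v / ?n" using Min_le_coordinate[OF v(1), of y] pos by simp
  ultimately have "\<delta> \<le> 0" by simp
  obtain w where w: "w \<in> F" "y w = ?n" using Min_attained[of y] by blast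
  have "x w / ?m = 1 + \<delta>" using diff[OF w(1)] w pos by simp
  moreover have "1 \<le> x w / ?m" using Min_le_coordinate[OF w(1), of x] pos by simp
  ultimately have "\<delta> = 0" using \<open>\<delta> \<le> 0\<close> by simp
  then have scaled: "x v = (?m / ?n) * y v" if "v \<in> F" for v
    using diff[OF that] pos by (simp add: field_simps)
  have "sum x F = (?m / ?n) * sum y F"
    unfolding sum_distrib_left by (rule sum.cong) (auto simp: scaled)
  then have "?m / ?n = 1" using x y by (simp add: realized_simplex_def)
  then have "x v = y v" if "v \<in> F" for v using scaled[OF that] by simp
  moreover have "x v = y v" if "v \<notin> F" for v using that x y by (simp add: realized_simplex_def)
  ultimately show ?thesis by blast
qed

lemma sphere_map_surj:
  assumes y: "y \<in> topspace (nsphere k)" "y \<noteq> nsphere_base"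
  shows "\<exists>x\<in>realized_simplex F. Min (x ` F) \<noteq> 0 \<and> sphere_map x = y"
proof -
  have ysum: "(y 0)\<^sup>2 + (\<Sum>i=1..k. (y i)\<^sup>2) = 1" and yk: "\<And>i. i > k \<Longrightarrow> y i = 0"
    using y(1) unfolding nsphere_eq_top_of_set by (auto simp: sum_split)
  \<comment> \<open>A coordinate 1 exhausts the sphere equation and leaves only the base
    point.\<close>
  have y0: "y 0 < 1"
  proof (rule ccontr)
    assume "\<not> y 0 < 1"
    then have "(y 0)\<^sup>2 \<ge> 1" by (simp add: power2_ge_1_iff)
    moreover have "(\<Sum>i=1..k. (y i)\<^sup>2) \<ge> 0" by (rule sum_nonneg) simp
    ultimately have s: "(\<Sum>i=1..k. (y i)\<^sup>2) = 0" "(y 0)\<^sup>2 = 1" using ysum by linarith+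
    then have "\<forall>i\<in>{1..k}. y i = 0" by (subst (asm) sum_nonneg_eq_0_iff) auto
    moreover have "y 0 = 1" using s(2) \<open>\<not> y 0 < 1\<close> by (auto simp: power2_eq_1_iff)
    ultimately have "y i = nsphere_base i" for i
      using yk[of i] by (cases "i = 0"; cases "i > k") (auto simp: nsphere_base_def)
    then show False using y(2) by blast
  qed
  \<comment> \<open>\<open>u\<close> is the stereographic projection of \<open>y\<close>, extended
    by 0 at index 0. Shifting it to minimum 1 and dividing by the total \<open>s\<close> gives the
    point of the simplex with these ratios.\<close>
  define u where "u i = (if i = 0 then 0 else y i / (1 - y 0))" for i
  define z where "z i = 1 + u i - Min (u ` {..k})" for i
  define s where "s = (\<Sum>i\<le>k. z i)"
  define x where "x v = (if v \<in> F then z (inv_into {..k} e v) / s else 0)" for v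
  have z1: "1 \<le> z i" if "i \<le> k" for i
  proof -
    have "Min (u ` {..k}) \<le> u i" using that by (intro Min_le) auto
    then show ?thesis unfolding z_def by linarith
  qed
  have "s > 0" unfolding s_def
    using z1 by (intro sum_pos) (auto intro: less_le_trans[OF zero_less_one])
  have xe: "x (e i) = z i / s" if "i \<le> k" for i
    using that inj e_in by (simp add: x_def)
  have "sum x F = (\<Sum>i\<le>k. z i / s)"
    unfolding sum_F by (rule sum.cong) (auto simp: xe)
  also have "\<dots> = 1" using \<open>s > 0\<close> by (simp add: s_def flip: sum_divide_distrib)
  finally have "sum x F = 1" .
  moreover have "0 \<le> x v" for v
  proof (cases "v \<in> F")
    case True
    then obtain i where "i \<le> k" "v = e i" by (auto simp: F_eq)
    then show ?thesis using z1[of i] xe \<open>s > 0\<close> by simp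
  qed (simp add: x_def)
  ultimately have xF: "x \<in> realized_simplex F" by (auto simp: realized_simplex_def x_def)
  have Minx: "Min (x ` F) = 1 / s"
  proof (rule Min_eqI)
    show "finite (x ` F)" using finF by simp
    show "1 / s \<le> b" if "b \<in> x ` F" for b
      using that z1 xe \<open>s > 0\<close> by (auto simp: F_eq divide_right_mono)
    have "Min (u ` {..k}) \<in> u ` {..k}" by (intro Min_in) auto
    then obtain i where "i \<le> k" "u i = Min (u ` {..k})" by (metis atMost_iff imageE)
    then have "x (e i) = 1 / s" by (simp add: xe z_def)
    then show "1 / s \<in> x ` F" using e_in[OF \<open>i \<le> k\<close>] by force
  qed
  have d: "x (e i) - x (e 0) = u i / s" if "i \<le> k" for i
  proof -
    have "z i - z 0 = u i" by (simp add: z_def u_def del: minus_Min_eq_Max)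
    then show ?thesis using that by (simp add: xe flip: diff_divide_distrib)
  qed
  have "sqdist x = (\<Sum>i=1..k. (y i)\<^sup>2 / (s * (1 - y 0))\<^sup>2)"
    unfolding sqdist_def by (rule sum.cong) (auto simp: d u_def power_divide power_mult_distrib mult.commute)
  also have "\<dots> = (1 - (y 0)\<^sup>2) / (s * (1 - y 0))\<^sup>2"
    using ysum by (simp flip: sum_divide_distrib)
  also have "\<dots> = ((1 + y 0) * (1 - y 0)) / (s\<^sup>2 * ((1 - y 0) * (1 - y 0)))"
    by (simp add: power2_eq_square algebra_simps)
  also have "\<dots> = (1 + y 0) / (s\<^sup>2 * (1 - y 0))"
    using y0 by simp
  finally have D: "sqdist x = (1 + y 0) / (s\<^sup>2 * (1 - y 0))" .
  have M2: "(Min (x ` F))\<^sup>2 = (1 - y 0) / (s\<^sup>2 * (1 - y 0))"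
    using y0 by (simp add: Minx power_divide)
  have plus: "sqdist x + (Min (x ` F))\<^sup>2 = 2 / (s\<^sup>2 * (1 - y 0))"
    and minus: "sqdist x - (Min (x ` F))\<^sup>2 = 2 * y 0 / (s\<^sup>2 * (1 - y 0))"
    unfolding D M2 add_divide_distrib[symmetric] diff_divide_distrib[symmetric] by simp_all
  have "sphere_map x i = y i" for i
  proof -
    consider "i = 0" | "i > k" | "i \<noteq> 0" "i \<le> k" by linarith
    then show ?thesis
    proof cases
      case 1
      then show ?thesis using y0 \<open>s > 0\<close> by (simp add: sphere_map_def plus minus)
    next
      case 2
      then show ?thesis by (simp add: sphere_map_def yk)
    next
      case 3
      have "sphere_map x i = 2 * Min (x ` F) * (x (e i) - x (e 0)) / (sqdist x + (Min (x ` F))\<^sup>2)"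
        using 3 by (simp add: sphere_map_def)
      also have "\<dots> = 2 * (1 / s) * (u i / s) / (2 / (s\<^sup>2 * (1 - y 0)))"
        unfolding plus d[OF 3(2)] unfolding Minx ..
      also have "\<dots> = u i * (1 - y 0)" using \<open>s > 0\<close> by (simp add: power2_eq_square)
      also have "\<dots> = y i" using 3 y0 by (simp add: u_def)
      finally show ?thesis .
    qed
  qed
  then have "sphere_map x = y" by blast
  then show ?thesis using xF Minx \<open>s > 0\<close> by (intro bexI[of _ x]) auto
qed

end

section \<open>Attaching top cells to a contractible complex\<close>

text \<open>A contraction of \<open>A\<close> that extends to a homotopy of \<open>X\<close> makes
  the collapse of \<open>A\<close> a homotopy equivalence: the end map of \<open>H\<close> factors
  through the quotient as the inverse \<open>g\<close>, and since \<open>H\<close> keeps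
  \<open>A\<close> inside \<open>A\<close> it descends to a homotopy on \<open>Y\<close>.\<close>

lemma homotopy_equivalent_collapse_subset:
  assumes q: "quotient_map X Y q"
    and H: "continuous_map (prod_topology (top_of_set {0..1::real}) X) X H"
    and H0: "\<And>x. x \<in> topspace X \<Longrightarrow> H (0, x) = x"
    and HA: "\<And>t x. t \<in> {0..1} \<Longrightarrow> x \<in> A \<Longrightarrow> H (t, x) \<in> A"
    and H1: "\<And>x. x \<in> A \<Longrightarrow> H (1, x) = a"
    and A: "A \<subseteq> topspace X"
    and qA: "\<And>x y. x \<in> A \<Longrightarrow> y \<in> A \<Longrightarrow> q x = q y"
    and qX: "\<And>x y. x \<in> topspace X \<Longrightarrow> y \<in> topspace X \<Longrightarrow> q x = q y \<Longrightarrow> x = y \<or> x \<in> A \<and> y \<in> A"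
  shows "X homotopy_equivalent_space Y"
proof -
  let ?I = "top_of_set {0..1::real}"
  have qc: "continuous_map X Y q" using q by (rule quotient_imp_continuous_map)
  have "continuous_map X (prod_topology ?I X) (\<lambda>x. (1, x))"
    by (intro continuous_map_pairedI) (auto simp: continuous_map_in_subtopology)
  then have H1c: "continuous_map X X (\<lambda>x. H (1, x))"
    using continuous_map_compose[OF _ H] by (fastforce simp: o_def)
  have "H (1, x) = H (1, y)" if "x \<in> topspace X" "y \<in> topspace X" "q x = q y" for x y
    using qX[OF that] H1 by auto
  then obtain g where g: "continuous_map Y X g" and gq: "\<And>x. x \<in> topspace X \<Longrightarrow> g (q x) = H (1, x)"
    using quotient_map_lift_exists[OF q H1c] by metis
  have gqi: "homotopic_with (\<lambda>_. True) X X (g \<circ> q) id"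
  proof (rule homotopic_with_sym[THEN iffD1])
    show "homotopic_with (\<lambda>_. True) X X id (g \<circ> q)"
      by (subst homotopic_with) (use H H0 gq in \<open>auto intro!: exI[of _ H]\<close>)
  qed
  \<comment> \<open>The interval is locally compact, so the product with it keeps \<open>q\<close> a
    quotient map, and \<open>q \<circ> H\<close> descends continuously.\<close>
  have Q: "quotient_map (prod_topology ?I X) (prod_topology ?I Y) (\<lambda>(t, x). (t, q x))"
  proof (rule quotient_map_prod_right[OF _ _ q])
    show "locally_compact_space ?I"
      by (simp add: compact_imp_locally_compact_space compact_space_subtopology)
    show "Hausdorff_space ?I \<or> regular_space ?I"
      by (simp add: Hausdorff_space_subtopology)
  qed
  have qH: "continuous_map (prod_topology ?I X) Y (q \<circ> H)"
    using continuous_map_compose[OF H qc] .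
  have "(q \<circ> H) p = (q \<circ> H) p'"
    if p: "p \<in> topspace (prod_topology ?I X)" "p' \<in> topspace (prod_topology ?I X)"
      and eq: "(\<lambda>(t, x). (t, q x)) p = (\<lambda>(t, x). (t, q x)) p'" for p p'
  proof -
    obtain t x t' x' where pp: "p = (t, x)" "p' = (t', x')" by (meson surj_pair)
    have tx: "t = t'" "q x = q x'" "t \<in> {0..1}" "x \<in> topspace X" "x' \<in> topspace X"
      using p eq pp by auto
    then have "x = x' \<or> x \<in> A \<and> x' \<in> A" using qX by blast
    then show ?thesis
      using tx pp HA[of t x] HA[of t x'] qA by auto
  qed
  then obtain G where G: "continuous_map (prod_topology ?I Y) Y G"
    and Gq: "\<And>p. p \<in> topspace (prod_topology ?I X) \<Longrightarrow> G ((\<lambda>(t, x). (t, q x)) p) = (q \<circ> H) p"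
    using quotient_map_lift_exists[OF Q qH] by metis
  have Gq': "G (t, q x) = q (H (t, x))" if "t \<in> {0..1}" "x \<in> topspace X" for t x
    using Gq[of "(t, x)"] that by simp
  have surj: "\<exists>x\<in>topspace X. y = q x" if "y \<in> topspace Y" for y
    using that quotient_imp_surjective_map[OF q] by blast
  have qgi: "homotopic_with (\<lambda>_. True) Y Y (q \<circ> g) id"
  proof (rule homotopic_with_sym[THEN iffD1])
    have "G (0, y) = id y \<and> G (1, y) = (q \<circ> g) y" if y: "y \<in> topspace Y" for y
      using surj[OF y] Gq'[of 0] Gq'[of 1] H0 gq by auto
    then show "homotopic_with (\<lambda>_. True) Y Y id (q \<circ> g)"
      by (subst homotopic_with) (use G in \<open>auto intro!: exI[of _ G]\<close>)
  qed
  show ?thesis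
    unfolding homotopy_equivalent_space_def using qc g gqi qgi by blast
qed

text \<open>The homothety about the barycentre with factor \<open>s\<close>; the factor
  \<open>1 / radius F k x\<close> gives the radial projection of \<open>x\<close> to the
  boundary.\<close>

definition dilate :: "'v set \<Rightarrow> nat \<Rightarrow> real \<Rightarrow> ('v \<Rightarrow> real) \<Rightarrow> 'v \<Rightarrow> real" where
  "dilate F k s x v = (if v \<in> F then 1 / real (Suc k) + s * (x v - 1 / real (Suc k)) else 0)"

text \<open>The gauge of the simplex about its barycentre: on the simplex it is 0 at the barycentre
  only and 1 exactly on the boundary.\<close>

definition radius :: "'v set \<Rightarrow> nat \<Rightarrow> ('v \<Rightarrow> real) \<Rightarrow> real" where
  "radius F k x = 1 - real (Suc k) * Min (x ` F)"

lemma dilate_1: "x \<in> realized_simplex F \<Longrightarrow> dilate F k 1 x = x"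
  by (auto simp: dilate_def realized_simplex_def)

context
  fixes F :: "'v set" and k :: nat
  assumes card: "card F = Suc k"
begin

lemma finite_if_card_Suc: "finite F" and nonempty_if_card_Suc: "F \<noteq> {}"
  using card card.infinite by fastforce+

lemma Min_simplex:
  fixes x :: "'v \<Rightarrow> real"
  shows "v \<in> F \<Longrightarrow> Min (x ` F) \<le> x v" "\<exists>v\<in>F. x v = Min (x ` F)"
proof -
  show "v \<in> F \<Longrightarrow> Min (x ` F) \<le> x v" using finite_if_card_Suc by simp
  have "Min (x ` F) \<in> x ` F" using finite_if_card_Suc nonempty_if_card_Suc by simp
  then show "\<exists>v\<in>F. x v = Min (x ` F)" by force
qed

lemma radius_bounds:
  assumes "x \<in> realized_simplex F"
  shows "0 \<le> radius F k x" "radius F k x \<le> 1"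
proof -
  have "real (card F) * Min (x ` F) \<le> sum x F"
    using sum_mono[of F "\<lambda>_. Min (x ` F)" x] Min_simplex(1) by simp
  then show "0 \<le> radius F k x"
    using assms by (simp add: radius_def card realized_simplex_def)
  have "0 \<le> Min (x ` F)"
    using finite_if_card_Suc nonempty_if_card_Suc realized_simplex_nonneg[OF assms] by simp
  then show "radius F k x \<le> 1" by (simp add: radius_def)
qed

text \<open>The least coordinate of the image is \<open>(1 - s * radius F k x) / Suc k\<close>, so
  the bound on \<open>s\<close> is exactly nonnegativity.\<close>

lemma dilate_in_simplex:
  assumes x: "x \<in> realized_simplex F" and s: "0 \<le> s" "s * radius F k x \<le> 1"
  shows "dilate F k s x \<in> realized_simplex F"
proof -
  have "0 \<le> dilate F k s x v" for v
  proof (cases "v \<in> F")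
    case True
    have "s * (Min (x ` F) - 1 / real (Suc k)) \<le> s * (x v - 1 / real (Suc k))"
      using Min_simplex(1)[OF True, of x] s by (intro mult_left_mono) auto
    moreover have "s * (Min (x ` F) - 1 / real (Suc k)) = - (s * radius F k x) / real (Suc k)"
      by (simp add: radius_def field_simps)
    moreover have "- (s * radius F k x) / real (Suc k) \<ge> - 1 / real (Suc k)"
      using s by (intro divide_right_mono) auto
    ultimately show ?thesis using True by (simp add: dilate_def)
  qed (simp add: dilate_def)
  moreover have "sum (dilate F k s x) F = 1"
  proof -
    have "sum (dilate F k s x) F = (\<Sum>v\<in>F. 1 / real (Suc k) + s * (x v - 1 / real (Suc k)))"
      by (simp add: dilate_def)
    also have "\<dots> = real (card F) / real (Suc k) + s * (sum x F - real (card F) / real (Suc k))"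
      by (simp add: sum.distrib sum_subtractf flip: sum_distrib_left)
    also have "\<dots> = 1" using x by (simp add: card realized_simplex_def)
    finally show ?thesis .
  qed
  ultimately show ?thesis by (auto simp: realized_simplex_def dilate_def)
qed

lemma dilate_boundary:
  assumes "s * radius F k x = 1"
  shows "\<exists>v\<in>F. dilate F k s x v = 0"
proof -
  obtain v where v: "v \<in> F" "x v = Min (x ` F)" using Min_simplex(2)[of x] by blast
  have "s * (Min (x ` F) - 1 / real (Suc k)) = - (s * radius F k x) / real (Suc k)"
    by (simp add: radius_def field_simps)
  then have "dilate F k s x v = 0" using v assms by (simp add: dilate_def)
  then show ?thesis using v by blast
qed

lemma continuous_on_radius: "continuous_on U (radius F k)"
proof -
  have "continuous_on U (\<lambda>x. Min (x ` F))"
    by (rule continuous_on_Min[OF finite_if_card_Suc nonempty_if_card_Suc, of _ "\<lambda>v x. x v"]) (rule continuous_on_coordinate)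
  then show ?thesis unfolding radius_def by (intro continuous_intros)
qed

end

lemma continuous_on_dilate:
  assumes "continuous_on U s" "continuous_on U f"
  shows "continuous_on U (\<lambda>p. dilate F k (s p) (f p))"
proof (rule continuous_on_coordinatewise_then_product)
  fix v
  show "continuous_on U (\<lambda>p. dilate F k (s p) (f p) v)"
    unfolding dilate_def using assms(1) continuous_on_product_then_coordinatewise[OF assms(2), of v]
    by (cases "v \<in> F") (auto intro!: continuous_intros)
qed

locale attached_cells =
  fixes L C :: "'v set set" and k :: nat
  assumes L: "simplicial_complex L" and Lne: "L \<noteq> {}"
    and contractible: "contractible_space (top_of_set (underlying_set L))"
    and finC: "finite C" and Cne: "C \<noteq> {}"
    and cardC: "\<And>F. F \<in> C \<Longrightarrow> card F = Suc k"
    and disjoint: "C \<inter> L = {}"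
    and boundary: "\<And>F c. F \<in> C \<Longrightarrow> c \<subset> F \<Longrightarrow> c \<noteq> {} \<Longrightarrow> c \<in> L"
begin

abbreviation "A \<equiv> underlying_set L"
abbreviation "X \<equiv> underlying_set (L \<union> C)"

lemma finite_cell: "F \<in> C \<Longrightarrow> finite F"
  using finite_if_card_Suc cardC by blast

lemma X_eq: "X = A \<union> (\<Union>F\<in>C. realized_simplex F)"
  by (auto simp: underlying_set_def)

lemma closed_A: "closed A"
  using L closed_underlying_set by (auto simp: simplicial_complex_def)

text \<open>A point with full support has \<open>F\<close> itself as carrier, and \<open>F\<close>
  is not in \<open>L\<close>.\<close>

lemma boundary_iff:
  assumes "F \<in> C" "x \<in> realized_simplex F"
  shows "x \<in> A \<longleftrightarrow> (\<exists>v\<in>F. x v = 0)"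
proof
  assume "x \<in> A"
  then have "support x \<in> L" by (rule support_in_complex[OF L])
  then have "support x \<noteq> F" using assms disjoint by auto
  then show "\<exists>v\<in>F. x v = 0" using support_subset[OF assms(2)] by (auto simp: support_def)
next
  assume "\<exists>v\<in>F. x v = 0"
  then have "support x \<subset> F" using support_subset[OF assms(2)] by (auto simp: support_def)
  then have "support x \<in> L" "finite (support x)"
    using boundary[OF assms(1)] support_nonempty[OF assms(2)] finite_cell[OF assms(1)]
    by (auto intro: finite_subset)
  then show "x \<in> A"
    using in_underlying_set_iff[OF L] realized_simplex_cong_support[OF assms(2)] finite_cell[OF assms(1)]
    by blast
qed

lemma boundary_iff_Min:
  assumes "F \<in> C" "x \<in> realized_simplex F"
  shows "x \<in> A \<longleftrightarrow> Min (x ` F) = 0"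
proof -
  have "(\<exists>v\<in>F. x v = 0) \<longleftrightarrow> Min (x ` F) = 0"
    using Min_simplex(1)[OF cardC[OF assms(1)], of _ x] Min_simplex(2)[OF cardC[OF assms(1)], of x] realized_simplex_nonneg[OF assms(2)]
    by (metis order_antisym)
  then show ?thesis using boundary_iff[OF assms] by simp
qed

text \<open>Distinct cells have equal size, so a common point has a zero coordinate in
  \<open>F\<close>.\<close>

lemma cells_meet_in_A:
  assumes "F \<in> C" "F' \<in> C" "F \<noteq> F'" "x \<in> realized_simplex F" "x \<in> realized_simplex F'"
  shows "x \<in> A"
proof -
  have "\<not> F \<subseteq> F'" using assms cardC finite_cell by (metis card_subset_eq)
  then obtain v where "v \<in> F" "v \<notin> F'" by blast
  then show ?thesis using boundary_iff[OF assms(1,4)] assms(5) by (auto simp: realized_simplex_def)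
qed

definition cell :: "('v \<Rightarrow> real) \<Rightarrow> 'v set" where
  "cell x = (SOME F. F \<in> C \<and> x \<in> realized_simplex F)"

lemma cell_eq:
  assumes "F \<in> C" "x \<in> realized_simplex F" "x \<notin> A"
  shows "cell x = F"
  unfolding cell_def using assms cells_meet_in_A by (intro some_equality) auto

text \<open>Radial flow extends the contraction \<open>h\<close> of \<open>A\<close> over the cells:
  a point is pushed outward by the factor \<open>1 + t\<close>, and one that would leave its cell is
  projected to the boundary and carried along by \<open>h\<close>.\<close>

lemma homotopy_extension:
  "\<exists>H a. continuous_map (prod_topology (top_of_set {0..1::real}) (top_of_set X)) (top_of_set X) H \<and>
     (\<forall>x\<in>X. H (0, x) = x) \<and> (\<forall>t\<in>{0..1}. \<forall>x\<in>A. H (t, x) \<in> A) \<and> (\<forall>x\<in>A. H (1, x) = a)"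
proof -
  obtain a h where hc: "continuous_map (prod_topology (top_of_set {0..1::real}) (top_of_set A)) (top_of_set A) h"
    and h0: "\<And>x. h (0, x) = x" and h1: "\<And>x. h (1, x) = a"
    using contractible unfolding contractible_space_def homotopic_with_def by auto
  have hcont: "continuous_on ({0..1} \<times> A) h" and hA: "\<And>t x. t \<in> {0..1} \<Longrightarrow> x \<in> A \<Longrightarrow> h (t, x) \<in> A"
    using hc by auto
  \<comment> \<open>The excess \<open>(1 + t) * radius F k x - 1\<close> serves as the time for
    \<open>h\<close>. It is 0 where the branches meet and equals \<open>t\<close> on the boundary,
    so \<open>G\<close> is continuous and agrees with \<open>h\<close> on \<open>A\<close>.\<close>
  define G where "G F p = (if (1 + fst p) * radius F k (snd p) \<le> 1
      then dilate F k (1 + fst p) (snd p)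
      else h ((1 + fst p) * radius F k (snd p) - 1, dilate F k (1 / radius F k (snd p)) (snd p)))"
    for F and p :: "real \<times> ('v \<Rightarrow> real)"
  define H where "H p = (if snd p \<in> A then h p else G (cell (snd p)) p)" for p
  have outer: "dilate F k (1 / radius F k x) x \<in> A"
    "(1 + t) * radius F k x - 1 \<in> {0..1}"
    if "F \<in> C" "x \<in> realized_simplex F" "t \<in> {0..1}" "1 \<le> (1 + t) * radius F k x" for F x t
  proof -
    note c = cardC[OF \<open>F \<in> C\<close>]
    have "radius F k x \<noteq> 0" using that(4) by auto
    then have r: "radius F k x > 0" "radius F k x \<le> 1" "1 / radius F k x * radius F k x = 1"
      using radius_bounds[OF c that(2)] by auto
    have "dilate F k (1 / radius F k x) x \<in> realized_simplex F"
      by (rule dilate_in_simplex[OF c that(2)]) (use r in auto)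
    then show "dilate F k (1 / radius F k x) x \<in> A"
      using boundary_iff[OF that(1)] dilate_boundary[OF c r(3)] by blast
    have "(1 + t) * radius F k x \<le> 2 * 1"
      using that r by (intro mult_mono) auto
    then show "(1 + t) * radius F k x - 1 \<in> {0..1}" using that by auto
  qed
  have Gcont: "continuous_on ({0..1} \<times> realized_simplex F) (G F)" if F: "F \<in> C" for F
  proof -
    note c = cardC[OF F]
    have rad: "continuous_on U (\<lambda>p. radius F k (snd p))" for U :: "(real \<times> ('v \<Rightarrow> real)) set"
      by (rule continuous_on_compose2[OF continuous_on_radius[OF c, of UNIV] continuous_on_snd])
         (auto intro: continuous_on_id)
    let ?U = "{0..1} \<times> realized_simplex F"
    let ?r = "\<lambda>p. (1 + fst p) * radius F k (snd p)"
    have pos: "radius F k (snd p) \<noteq> 0" if "1 \<le> ?r p" for p :: "real \<times> ('v \<Rightarrow> real)"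
      using that by auto
    show ?thesis
      unfolding G_def
    proof (rule continuous_on_cases_le)
      show "continuous_on {p \<in> ?U. ?r p \<le> 1} (\<lambda>p. dilate F k (1 + fst p) (snd p))"
        by (intro continuous_on_dilate continuous_intros)
      show "continuous_on {p \<in> ?U. 1 \<le> ?r p}
         (\<lambda>p. h (?r p - 1, dilate F k (1 / radius F k (snd p)) (snd p)))"
      proof (rule continuous_on_compose2[OF hcont])
        show "continuous_on {p \<in> ?U. 1 \<le> ?r p}
            (\<lambda>p. (?r p - 1, dilate F k (1 / radius F k (snd p)) (snd p)))"
          by (intro continuous_on_dilate continuous_intros rad) (use pos in auto)
        show "(\<lambda>p. (?r p - 1, dilate F k (1 / radius F k (snd p)) (snd p))) ` {p \<in> ?U. 1 \<le> ?r p}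
            \<subseteq> {0..1} \<times> A"
          using outer[OF F] by auto
      qed
      show "continuous_on ?U ?r" by (intro continuous_intros rad)
      show "dilate F k (1 + fst p) (snd p) = h (?r p - 1, dilate F k (1 / radius F k (snd p)) (snd p))"
        if "p \<in> ?U" "?r p = 1" for p
      proof -
        have "1 + fst p = 1 / radius F k (snd p)" using that(2) pos[of p] by (simp add: field_simps)
        then show ?thesis using that(2) h0 by simp
      qed
    qed
  qed
  have HG: "H (t, x) = G F (t, x)" if F: "F \<in> C" and x: "x \<in> realized_simplex F" and t: "t \<in> {0..1}" for F t x
  proof (cases "x \<in> A")
    case True
    then have "radius F k x = 1" using boundary_iff_Min[OF F x] by (simp add: radius_def)
    then show ?thesis
      using True t h0 by (auto simp: H_def G_def dilate_1[OF x])
  next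
    case False
    then show ?thesis using cell_eq[OF F x] by (simp add: H_def)
  qed
  have Gin: "G F (t, x) \<in> X" if F: "F \<in> C" and x: "x \<in> realized_simplex F" and t: "t \<in> {0..1}" for F t x
  proof (cases "(1 + t) * radius F k x \<le> 1")
    case True
    then have "dilate F k (1 + t) x \<in> realized_simplex F"
      using t by (intro dilate_in_simplex[OF cardC[OF F] x]) auto
    then show ?thesis using True F by (auto simp: G_def X_eq)
  next
    case False
    then show ?thesis using outer[OF F x t] hA by (auto simp: G_def X_eq)
  qed
  have "continuous_on (({0..1} \<times> A) \<union> (\<Union>F\<in>C. {0..1} \<times> realized_simplex F)) H"
  proof (rule continuous_on_closed_Un)
    show "closed ({0..1::real} \<times> A)" using closed_A by (intro closed_Times) auto
    show "closed (\<Union>F\<in>C. {0..1::real} \<times> realized_simplex F)"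
      using finC closed_realized_simplex by (intro closed_UN ballI closed_Times) auto
    show "continuous_on ({0..1} \<times> A) H"
      using hcont by (rule continuous_on_eq) (auto simp: H_def)
    show "continuous_on (\<Union>F\<in>C. {0..1} \<times> realized_simplex F) H"
    proof (rule continuous_on_closed_Union[OF finC])
      fix F assume F: "F \<in> C"
      show "closed ({0..1::real} \<times> realized_simplex F)"
        using closed_realized_simplex by (intro closed_Times) auto
      show "continuous_on ({0..1} \<times> realized_simplex F) H"
        using Gcont[OF F] by (rule continuous_on_eq) (auto simp: HG[OF F])
    qed
  qed
  moreover have "({0..1::real} \<times> A) \<union> (\<Union>F\<in>C. {0..1} \<times> realized_simplex F) = {0..1} \<times> X"
    unfolding X_eq by auto
  ultimately have Hcont: "continuous_on ({0..1} \<times> X) H" by simp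
  have Hin: "H (t, x) \<in> X" if "t \<in> {0..1}" "x \<in> X" for t x
  proof (cases "x \<in> A")
    case True
    then show ?thesis using hA[OF that(1)] by (auto simp: H_def X_eq)
  next
    case False
    then obtain F where F: "F \<in> C" "x \<in> realized_simplex F" using \<open>x \<in> X\<close> by (auto simp: X_eq)
    then show ?thesis using HG[OF F that(1)] Gin[OF F that(1)] by simp
  qed
  have H0: "H (0, x) = x" if "x \<in> X" for x
  proof (cases "x \<in> A")
    case False
    then obtain F where F: "F \<in> C" "x \<in> realized_simplex F" using \<open>x \<in> X\<close> by (auto simp: X_eq)
    then show ?thesis
      using HG[OF F, of 0] radius_bounds(2)[OF cardC[OF F(1)] F(2)] dilate_1[OF F(2)] by (simp add: G_def)
  qed (simp add: H_def h0)
  have "continuous_map (prod_topology (top_of_set {0..1::real}) (top_of_set X)) (top_of_set X) H"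
    using Hcont Hin by auto
  moreover have "\<forall>t\<in>{0..1}. \<forall>x\<in>A. H (t, x) \<in> A" "\<forall>x\<in>A. H (1, x) = a"
    using hA h1 by (auto simp: H_def)
  ultimately show ?thesis using H0 by blast
qed

end

context attached_cells begin

text \<open>The map \<open>q\<close> sends \<open>A\<close> to the wedge point and each cell to its
  own sphere. It is a closed continuous surjection identifying only points of \<open>A\<close>, so
  the wedge is \<open>X\<close> with \<open>A\<close> collapsed, and the extended contraction makes
  \<open>q\<close> a homotopy equivalence.\<close>

theorem homotopy_equivalent_sphere_wedge:
  "top_of_set X homotopy_equivalent_space sphere_wedge (card C) k"
proof -
  define m where "m = card C"
  have m0: "0 < m" using finC Cne by (simp add: m_def card_gt_0_iff)
  obtain \<iota> where \<iota>: "bij_betw \<iota> {..<m} C"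
    using ex_bij_betw_nat_finite[OF finC] by (auto simp: m_def lessThan_atLeast0)
  have \<iota>C: "\<iota> j \<in> C" if "j < m" for j using \<iota> that by (auto simp: bij_betw_def)
  have "\<forall>F\<in>C. \<exists>e. bij_betw e {..k} F"
  proof
    fix F assume F: "F \<in> C"
    show "\<exists>e. bij_betw e {..k} F"
      using ex_bij_betw_nat_finite[OF finite_cell[OF F]]
      by (simp add: cardC[OF F] atLeast0LessThan lessThan_Suc_atMost)
  qed
  then obtain e where e: "\<And>F. F \<in> C \<Longrightarrow> bij_betw (e F) {..k} F" by metis
  have es: "enumerated_simplex (e F) F k" if "F \<in> C" for F
    by (rule enumerated_simplex.intro) (rule e[OF that])
  define \<phi> where "\<phi> j = enumerated_simplex.sphere_map (e (\<iota> j)) (\<iota> j) k" for j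
  define S where "S = sum_topology (\<lambda>_::nat. nsphere k) {..<m}"
  define \<rho> where "\<rho> = wedge_rel {..<m} (\<lambda>_::nat. nsphere k) (\<lambda>_. nsphere_base)"
  define \<pi> where "\<pi> p = \<rho> `` {p}" for p
  define W where "W = sphere_wedge m k"
  have topS: "topspace S = {..<m} \<times> topspace (nsphere k)" by (auto simp: S_def)
  have equiv: "equiv (topspace S) \<rho>" unfolding S_def \<rho>_def by (rule equiv_wedge_rel)
  have Wq: "W = quotient_topology S \<rho>"
    by (simp add: W_def sphere_wedge_def wedge_sum_def S_def \<rho>_def)
  have qm: "quotient_map S W \<pi>"
    unfolding Wq \<pi>_def by (rule quotient_map_quotient_topology[OF equiv])
  have topW: "topspace W = \<pi> ` topspace S"
    using quotient_imp_surjective_map[OF qm] by simp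
  have \<pi>eq: "\<pi> (j, y) = \<pi> (j', y') \<longleftrightarrow> j = j' \<and> y = y' \<or> y = nsphere_base \<and> y' = nsphere_base"
    if "j < m" "j' < m" "y \<in> topspace (nsphere k)" "y' \<in> topspace (nsphere k)" for j j' y y'
    unfolding \<pi>_def
    by (subst eq_equiv_class_iff[OF equiv])
       (use that in \<open>auto simp: \<rho>_def wedge_rel_def topS\<close>)
  have base: "nsphere_base \<in> topspace (nsphere k)" by (rule nsphere_base_in_nsphere)
  have \<phi>_in: "\<phi> j x \<in> topspace (nsphere k)" if "j < m" "x \<in> realized_simplex (\<iota> j)" for j x
    unfolding \<phi>_def using enumerated_simplex.sphere_map_in_nsphere[OF es[OF \<iota>C[OF that(1)]] that(2)] .
  have \<phi>_base: "\<phi> j x = nsphere_base \<longleftrightarrow> x \<in> A" if "j < m" "x \<in> realized_simplex (\<iota> j)" for j x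
    unfolding \<phi>_def
    using enumerated_simplex.sphere_map_base_iff[OF es[OF \<iota>C[OF that(1)]] that(2)]
      boundary_iff_Min[OF \<iota>C[OF that(1)] that(2)] by simp
  have \<phi>_inj: "x = y" if "j < m" "x \<in> realized_simplex (\<iota> j)" "x \<notin> A"
    "y \<in> realized_simplex (\<iota> j)" "y \<notin> A" "\<phi> j x = \<phi> j y" for j x y
    using enumerated_simplex.sphere_map_inj[OF es[OF \<iota>C[OF that(1)]] that(2) _ that(4)] that
      boundary_iff_Min[OF \<iota>C[OF that(1)]] by (auto simp: \<phi>_def)
  have \<phi>_surj: "\<exists>x\<in>realized_simplex (\<iota> j). \<phi> j x = y"
    if "j < m" "y \<in> topspace (nsphere k)" "y \<noteq> nsphere_base" for j y
    using enumerated_simplex.sphere_map_surj[OF es[OF \<iota>C[OF that(1)]] that(2,3)] by (auto simp: \<phi>_def)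
  have \<phi>_cont: "continuous_map (top_of_set (realized_simplex (\<iota> j))) (nsphere k) (\<phi> j)" if "j < m" for j
  proof -
    have "continuous_on (realized_simplex (\<iota> j)) (\<phi> j)"
      unfolding \<phi>_def using enumerated_simplex.continuous_on_sphere_map[OF es[OF \<iota>C[OF that]]] .
    then show ?thesis
      using \<phi>_in[OF that] unfolding nsphere_eq_top_of_set by auto
  qed
  \<comment> \<open>All base points are identified, so the one in summand 0 can stand for the wedge
    point.\<close>
  define q where "q x = (if x \<in> A then \<pi> (0, nsphere_base)
      else let j = inv_into {..<m} \<iota> (cell x) in \<pi> (j, \<phi> j x))" for x
  have q_cell: "q x = \<pi> (j, \<phi> j x)" if j: "j < m" and x: "x \<in> realized_simplex (\<iota> j)" for j x
  proof (cases "x \<in> A")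
    case True
    then show ?thesis
      using \<phi>_base[OF j x] \<pi>eq[OF m0 j base base] by (simp add: q_def)
  next
    case False
    then have "inv_into {..<m} \<iota> (cell x) = j"
      using cell_eq[OF \<iota>C[OF j] x] \<iota> j by (simp add: bij_betw_def)
    then show ?thesis using False by (simp add: q_def)
  qed
  have X_cases: "x \<in> A \<or> (\<exists>j<m. x \<in> realized_simplex (\<iota> j))" if "x \<in> X" for x
    using that \<iota> unfolding X_eq bij_betw_def by auto
  have q_in: "q x \<in> topspace W" if "x \<in> X" for x
    using X_cases[OF that]
  proof
    assume "x \<in> A"
    then show ?thesis using m0 base by (auto simp: q_def topW topS)
  next
    assume "\<exists>j<m. x \<in> realized_simplex (\<iota> j)"
    then show ?thesis using q_cell \<phi>_in by (auto simp: topW topS)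
  qed
  have q_cont_cell: "continuous_map (top_of_set (realized_simplex (\<iota> j))) W q" if j: "j < m" for j
  proof -
    have "continuous_map (nsphere k) S (\<lambda>y. (j, y))"
      unfolding S_def using continuous_map_component_injection[of j "{..<m}" "\<lambda>_. nsphere k"] j by simp
    then have "continuous_map (nsphere k) W (\<pi> \<circ> (\<lambda>y. (j, y)))"
      using continuous_map_compose quotient_imp_continuous_map[OF qm] by blast
    then have "continuous_map (top_of_set (realized_simplex (\<iota> j))) W ((\<pi> \<circ> (\<lambda>y. (j, y))) \<circ> \<phi> j)"
      using continuous_map_compose \<phi>_cont[OF j] by blast
    then show ?thesis
      by (rule continuous_map_eq) (simp add: q_cell[OF j])
  qed
  have q_cont: "continuous_map (top_of_set X) W q"
  proof (rule pasting_lemma_closed[where I = "insert A (realized_simplex ` C)" and T = "\<lambda>U. U" and f = "\<lambda>_. q"])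
    show "finite (insert A (realized_simplex ` C))" using finC by simp
    show "closedin (top_of_set X) U" if "U \<in> insert A (realized_simplex ` C)" for U
      using that closed_A closed_realized_simplex by (auto simp: X_eq intro!: closed_subset)
    show "continuous_map (subtopology (top_of_set X) U) W q" if U: "U \<in> insert A (realized_simplex ` C)" for U
    proof -
      have sub: "subtopology (top_of_set X) U = top_of_set U"
        using U by (auto simp: subtopology_subtopology X_eq inf_absorb2 intro!: arg_cong[of _ _ top_of_set])
      consider "U = A" | j where "j < m" "U = realized_simplex (\<iota> j)"
        using U \<iota> by (auto simp: bij_betw_def)
      then show ?thesis
      proof cases
        case 1
        have "continuous_map (top_of_set A) W (\<lambda>_. \<pi> (0, nsphere_base))"
          using m0 base by (simp add: topW topS)
        then have "continuous_map (top_of_set A) W q"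
          by (rule continuous_map_eq) (simp add: q_def)
        then show ?thesis using 1 sub by simp
      next
        case 2
        then show ?thesis using q_cont_cell sub by simp
      qed
    qed
    show "\<exists>U. U \<in> insert A (realized_simplex ` C) \<and> x \<in> U \<and> q x = q x" if "x \<in> topspace (top_of_set X)" for x
      using that by (auto simp: X_eq)
  qed auto
  \<comment> \<open>Closedness in the wedge is tested sphere by sphere; on one sphere the image of
    \<open>D\<close> is the image of its part in a single cell, possibly with the base point
    added.\<close>
  have fiber: "{y \<in> topspace (nsphere k). \<pi> (j, y) \<in> q ` D} =
      \<phi> j ` (D \<inter> realized_simplex (\<iota> j)) \<union> (if \<pi> (0, nsphere_base) \<in> q ` D then {nsphere_base} else {})"
    (is "?l = ?r") if j: "j < m" and D: "D \<subseteq> X" for j D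
  proof
    show "?r \<subseteq> ?l"
      using \<phi>_in[OF j] q_cell[OF j] \<pi>eq[OF m0 j base base] base
      by (auto simp: image_iff split: if_splits)
    show "?l \<subseteq> ?r"
    proof
      fix y assume "y \<in> ?l"
      then obtain x where y: "y \<in> topspace (nsphere k)" and x: "x \<in> D" "\<pi> (j, y) = q x" by auto
      show "y \<in> ?r"
      proof (cases "y = nsphere_base")
        case True
        then have "\<pi> (0, nsphere_base) = q x" using x \<pi>eq[OF m0 j base base] by simp
        then show ?thesis using True x(1) by auto
      next
        case False
        have "x \<notin> A"
        proof
          assume "x \<in> A"
          then have "\<pi> (j, y) = \<pi> (0, nsphere_base)" using x by (simp add: q_def)
          then show False using False \<pi>eq[OF j m0 y base] by simp
        qed
        then obtain i where i: "i < m" "x \<in> realized_simplex (\<iota> i)" using X_cases x D by blast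
        then have "\<pi> (j, y) = \<pi> (i, \<phi> i x)" using x q_cell by simp
        then have "j = i" "y = \<phi> i x" using \<pi>eq[OF j i(1) y \<phi>_in[OF i]] False by auto
        then show ?thesis using x i by auto
      qed
    qed
  qed
  have q_closed: "closed_map (top_of_set X) W q"
    unfolding closed_map_def
  proof (intro allI impI)
    fix D assume D: "closedin (top_of_set X) D"
    then have DX: "D \<subseteq> X" using closedin_subset by fastforce
    have "closed D"
      using D closed_A finC closed_realized_simplex
      by (metis X_eq closed_UN closed_Un closedin_closed_trans)
    have "closedin (nsphere k) {y \<in> topspace (nsphere k). \<pi> (j, y) \<in> q ` D}" if j: "j < m" for j
    proof -
      have "compact (D \<inter> realized_simplex (\<iota> j))"
        using \<open>closed D\<close> compact_realized_simplex[OF finite_cell[OF \<iota>C[OF j]]]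
        by (simp add: closed_Int_compact)
      then have "compactin (top_of_set (realized_simplex (\<iota> j))) (D \<inter> realized_simplex (\<iota> j))"
        by (simp add: compactin_subtopology)
      then have "compactin (nsphere k) (\<phi> j ` (D \<inter> realized_simplex (\<iota> j)))"
        using image_compactin \<phi>_cont[OF j] by blast
      then have "closedin (nsphere k) (\<phi> j ` (D \<inter> realized_simplex (\<iota> j)))"
        using compactin_imp_closedin Hausdorff_nsphere by blast
      moreover have "closedin (nsphere k) {nsphere_base}"
        by (simp add: closedin_Hausdorff_singleton Hausdorff_nsphere base)
      ultimately show ?thesis unfolding fiber[OF j DX] by (intro closedin_Un) simp_all
    qed
    moreover have "{y. (j, y) \<in> {p \<in> topspace S. \<pi> p \<in> q ` D}} = {y \<in> topspace (nsphere k). \<pi> (j, y) \<in> q ` D}"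
      if "j < m" for j
      using that by (auto simp: topS)
    ultimately have "closedin S {p \<in> topspace S. \<pi> p \<in> q ` D}"
      unfolding S_def closedin_sum_topology by (auto simp flip: S_def simp: topS)
    moreover have "q ` D \<subseteq> topspace W" using q_in DX by blast
    ultimately show "closedin W (q ` D)"
      using qm unfolding quotient_map_closedin by simp
  qed
  have Ane: "A \<noteq> {}"
  proof -
    obtain c where c: "c \<in> L" "c \<noteq> {}" "finite c" using L Lne unfolding simplicial_complex_def by blast
    then obtain v where "v \<in> c" by blast
    then have "(\<lambda>u. if u = v then 1 else 0) \<in> realized_simplex c"
      using c by (auto simp: realized_simplex_def)
    then show ?thesis using c by (auto simp: underlying_set_def)
  qed
  have q_surj: "q ` X = topspace W"
  proof
    show "q ` X \<subseteq> topspace W" using q_in by blast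
    show "topspace W \<subseteq> q ` X"
    proof
      fix w assume "w \<in> topspace W"
      then obtain j y where jy: "j < m" "y \<in> topspace (nsphere k)" "w = \<pi> (j, y)"
        by (auto simp: topW topS)
      show "w \<in> q ` X"
      proof (cases "y = nsphere_base")
        case True
        obtain x where "x \<in> A" using Ane by blast
        then have "x \<in> X" "q x = w" using True jy \<pi>eq[OF m0 jy(1) base base] by (auto simp: q_def X_eq)
        then show ?thesis by blast
      next
        case False
        then obtain x where x: "x \<in> realized_simplex (\<iota> j)" "\<phi> j x = y" using \<phi>_surj jy by blast
        then have "q x = w" "x \<in> X" using q_cell[OF jy(1)] \<iota>C[OF jy(1)] jy by (auto simp: X_eq)
        then show ?thesis by blast
      qed
    qed
  qed
  have Q: "quotient_map (top_of_set X) W q"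
    using continuous_closed_imp_quotient_map[OF q_cont q_closed] q_surj by simp
  have base_fiber: "x \<in> A" if "x \<in> X" "q x = \<pi> (0, nsphere_base)" for x
  proof (rule ccontr)
    assume "x \<notin> A"
    then obtain j where j: "j < m" "x \<in> realized_simplex (\<iota> j)" using X_cases \<open>x \<in> X\<close> by blast
    then have "\<phi> j x = nsphere_base"
      using that(2) q_cell[OF j] \<pi>eq[OF j(1) m0 \<phi>_in[OF j] base] by auto
    then show False using \<phi>_base[OF j] \<open>x \<notin> A\<close> by simp
  qed
  have qX: "x = y \<or> x \<in> A \<and> y \<in> A" if x: "x \<in> X" and y: "y \<in> X" and eq: "q x = q y" for x y
  proof (cases "x \<in> A \<or> y \<in> A")
    case True
    then have "q x = \<pi> (0, nsphere_base)" "q y = \<pi> (0, nsphere_base)" using eq by (auto simp: q_def)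
    then show ?thesis using base_fiber x y by blast
  next
    case False
    then obtain i j where i: "i < m" "x \<in> realized_simplex (\<iota> i)" and j: "j < m" "y \<in> realized_simplex (\<iota> j)"
      using X_cases x y by blast
    have "\<pi> (i, \<phi> i x) = \<pi> (j, \<phi> j y)" using eq q_cell i j by simp
    then have "i = j \<and> \<phi> i x = \<phi> j y"
      using \<pi>eq[OF i(1) j(1) \<phi>_in[OF i] \<phi>_in[OF j]] \<phi>_base[OF i] \<phi>_base[OF j] False by auto
    then show ?thesis using \<phi>_inj i j False by blast
  qed
  obtain H a where H: "continuous_map (prod_topology (top_of_set {0..1::real}) (top_of_set X)) (top_of_set X) H"
    "\<forall>x\<in>X. H (0, x) = x" "\<forall>t\<in>{0..1}. \<forall>x\<in>A. H (t, x) \<in> A" "\<forall>x\<in>A. H (1, x) = a"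
    using homotopy_extension by blast
  have "top_of_set X homotopy_equivalent_space W"
  proof (rule homotopy_equivalent_collapse_subset[OF Q H(1)])
    show "A \<subseteq> topspace (top_of_set X)" by (auto simp: X_eq)
    show "q x = q y" if "x \<in> A" "y \<in> A" for x y using that by (simp add: q_def)
    show "x = y \<or> x \<in> A \<and> y \<in> A"
      if "x \<in> topspace (top_of_set X)" "y \<in> topspace (top_of_set X)" "q x = q y" for x y
      using qX that by simp
  qed (use H(2-4) in auto)
  then show ?thesis by (simp add: W_def m_def)
qed

end

section \<open>Maximal chains of middle-sized sets\<close>

text \<open>The rank, which counts the elements of smaller key, is a bijection from \<open>V\<close>
  onto \<open>{..<card V}\<close>.\<close>

lemma card_initial_segment:
  fixes key :: "'a \<Rightarrow> 'b::linorder"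
  assumes fin: "finite V" and inj: "inj_on key V" and j: "j \<le> card V"
  shows "card {x \<in> V. card {y \<in> V. key y < key x} < j} = j"
proof -
  define rank where "rank x = card {y \<in> V. key y < key x}" for x
  have less: "rank x < rank x'" if "x \<in> V" "x' \<in> V" "key x < key x'" for x x'
    unfolding rank_def using that fin by (intro psubset_card_mono) auto
  have "inj_on rank V"
  proof (rule inj_onI)
    fix x y assume xy: "x \<in> V" "y \<in> V" "rank x = rank y"
    then have "key x = key y" using less by (metis less_irrefl linorder_neqE)
    then show "x = y" using inj xy by (auto dest: inj_onD)
  qed
  moreover have "rank ` V \<subseteq> {..<card V}"
    unfolding rank_def using fin by (auto intro!: psubset_card_mono)
  ultimately have "rank ` V = {..<card V}"
    by (simp add: card_image card_subset_eq)
  moreover have "rank ` {x \<in> V. rank x < j} = rank ` V \<inter> {..<j}" by blast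
  ultimately have "rank ` {x \<in> V. rank x < j} = {..<j}" using j by auto
  then have "card {x \<in> V. rank x < j} = card {..<j}"
    using \<open>inj_on rank V\<close> by (metis (no_types, lifting) card_image inj_on_subset mem_Collect_eq subsetI)
  then show ?thesis by (simp add: rank_def)
qed

text \<open>The two differences have the same size, and \<open>Max (A - B)\<close> separates their
  elements.\<close>

lemma sum_less_if_differences_less:
  fixes A B :: "nat set"
  assumes "finite A" "finite B" "card A = card B" "A \<noteq> B"
    and less: "\<And>a b. a \<in> A - B \<Longrightarrow> b \<in> B - A \<Longrightarrow> a < b"
  shows "\<Sum>A < \<Sum>B"
proof -
  have card_eq: "card (A - B) = card (B - A)"
    using assms card_Diff_subset_Int[of A B] card_Diff_subset_Int[of B A] by (simp add: Int_commute)
  have "A - B \<noteq> {}"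
  proof
    assume "A - B = {}"
    then have "A \<subseteq> B" by blast
    then show False using assms card_subset_eq by blast
  qed
  moreover have "finite (A - B)" using assms by simp
  ultimately have M: "Max (A - B) \<in> A - B" "\<And>a. a \<in> A - B \<Longrightarrow> a \<le> Max (A - B)" "card (A - B) > 0"
    using Max_in[of "A - B"] by (simp_all add: card_gt_0_iff)
  have ne: "B - A \<noteq> {}" using card_eq M(3) by (metis card.empty less_irrefl)
  have "\<Sum>(A - B) \<le> card (A - B) * Max (A - B)"
    using sum_bounded_above[of "A - B" "\<lambda>x. x" "Max (A - B)"] M(2) by simp
  also have "\<dots> = (\<Sum>b\<in>B - A. Max (A - B))" by (simp add: card_eq)
  also have "\<dots> < \<Sum>(B - A)"
    using assms(2) ne less[OF M(1)] by (intro sum_strict_mono) auto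
  finally have "\<Sum>(A - B) < \<Sum>(B - A)" .
  moreover have "\<Sum>A = \<Sum>(A \<inter> B) + \<Sum>(A - B)" "\<Sum>B = \<Sum>(A \<inter> B) + \<Sum>(B - A)"
    using sum.Int_Diff[OF assms(1), of "\<lambda>x. x" B] sum.Int_Diff[OF assms(2), of "\<lambda>x. x" A]
    by (simp_all add: Int_commute)
  ultimately show ?thesis by simp
qed

text \<open>There are k + 1 admissible sizes, so maximal chains span k-dimensional
  simplices.\<close>

definition middle_sets :: "nat \<Rightarrow> nat set set" where
  "middle_sets k = {A. A \<subseteq> {1..k + 6} \<and> 3 \<le> card A \<and> card A \<le> k + 3}"

text \<open>A maximal chain in \<^const>\<open>middle_sets\<close>, listed by cardinality and padded by the empty set
  below size 3 and by the whole ground set above size \<^term>\<open>k + 3\<close>.\<close>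

definition flag :: "nat \<Rightarrow> (nat \<Rightarrow> nat set) \<Rightarrow> bool" where
  "flag k A \<longleftrightarrow> (\<forall>i<3. A i = {}) \<and> (\<forall>i>k + 3. A i = {1..k + 6}) \<and>
     (\<forall>i\<in>{3..k + 3}. A i \<subseteq> {1..k + 6} \<and> card (A i) = i) \<and> (\<forall>i. A i \<subseteq> A (Suc i))"

definition facet :: "nat \<Rightarrow> (nat \<Rightarrow> nat set) \<Rightarrow> nat set set" where
  "facet k A = A ` {3..k + 3}"

text \<open>The padding lets both ends count as steps: \<open>A 3 - A 2\<close> is the whole bottom
  set and \<open>A (k + 4) - A (k + 3)\<close> the complement of the top set, three elements each.
  The steps between them add a single element.\<close>

definition descent :: "(nat \<Rightarrow> nat set) \<Rightarrow> nat \<Rightarrow> bool" where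
  "descent A i \<longleftrightarrow> (\<exists>a\<in>A i - A (i - 1). \<exists>b\<in>A (Suc i) - A i. b < a)"

lemma finite_middle_sets: "finite (middle_sets k)"
  by (rule finite_subset[of _ "Pow {1..k + 6}"]) (auto simp: middle_sets_def)

lemma flag_mono: "flag k A \<Longrightarrow> i \<le> j \<Longrightarrow> A i \<subseteq> A j"
  using lift_Suc_mono_le[of A i j] by (simp add: flag_def)

lemma flag_subset: "flag k A \<Longrightarrow> A i \<subseteq> {1..k + 6}"
  using flag_mono[of k A i "max i (k + 4)"] by (auto simp: flag_def)

lemma flag_finite: "flag k A \<Longrightarrow> finite (A i)"
  by (rule finite_subset[OF flag_subset]) auto

lemma flag_card: "flag k A \<Longrightarrow> 3 \<le> i \<Longrightarrow> i \<le> k + 3 \<Longrightarrow> card (A i) = i"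
  by (auto simp: flag_def)

lemma flag_empty: "flag k A \<Longrightarrow> i < 3 \<Longrightarrow> A i = {}"
  by (auto simp: flag_def)

lemma flag_top: "flag k A \<Longrightarrow> k + 3 < i \<Longrightarrow> A i = {1..k + 6}"
  by (auto simp: flag_def)

lemma flag_inj_on: "flag k A \<Longrightarrow> inj_on A {3..k + 3}"
  by (rule inj_onI) (metis atLeastAtMost_iff flag_card)

lemma card_facet: "flag k A \<Longrightarrow> card (facet k A) = Suc k"
  by (simp add: facet_def card_image flag_inj_on)

lemma flag_level_in_facet:
  assumes "flag k A" "flag k B" "A i \<in> facet k B" "3 \<le> i" "i \<le> k + 3"
  shows "A i = B i"
proof -
  obtain j where j: "j \<in> {3..k + 3}" "A i = B j" using assms(3) by (auto simp: facet_def)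
  then have "i = j" using flag_card[OF assms(1,4,5)] flag_card[OF assms(2), of j] by simp
  then show ?thesis using j by simp
qed

lemma flag_eqI:
  assumes "flag k A" "flag k B" "\<And>i. 3 \<le> i \<Longrightarrow> i \<le> k + 3 \<Longrightarrow> A i = B i"
  shows "A = B"
proof
  fix i
  consider "i < 3" | "k + 3 < i" | "3 \<le> i" "i \<le> k + 3" by linarith
  then show "A i = B i"
    by cases (simp_all add: assms(3) flag_empty[OF assms(1)] flag_empty[OF assms(2)]
        flag_top[OF assms(1)] flag_top[OF assms(2)])
qed

lemma facet_inj:
  assumes "flag k A" "flag k B" "facet k A = facet k B"
  shows "A = B"
proof (rule flag_eqI[OF assms(1,2)])
  fix i assume i: "3 \<le> i" "i \<le> k + 3"
  then have "A i \<in> facet k A" by (simp add: facet_def)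
  then show "A i = B i" using flag_level_in_facet[OF assms(1,2) _ i] assms(3) by simp
qed

lemma flag_step_nonempty:
  assumes "flag k A" "3 \<le> i" "i \<le> k + 3"
  shows "A (Suc i) - A i \<noteq> {}"
proof
  assume "A (Suc i) - A i = {}"
  then have "card (A (Suc i)) \<le> card (A i)"
    by (intro card_mono flag_finite[OF assms(1)]) auto
  moreover have "card (A (Suc i)) > i"
    using flag_card[OF assms(1), of "Suc i"] flag_top[OF assms(1), of "Suc i"] assms
    by (cases "Suc i \<le> k + 3") auto
  ultimately show False using flag_card[OF assms] by simp
qed

lemma flag_step_insert:
  assumes "flag k A" "3 \<le> i" "Suc i \<le> k + 3" "b \<in> A (Suc i) - A i"
  shows "A (Suc i) = insert b (A i)"
proof -
  have "insert b (A i) \<subseteq> A (Suc i)" using assms flag_mono[OF assms(1), of i "Suc i"] by auto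
  moreover have "card (insert b (A i)) = card (A (Suc i))"
    using assms flag_card[OF assms(1)] flag_finite[OF assms(1)] by simp
  ultimately show ?thesis using flag_finite[OF assms(1)] card_subset_eq by metis
qed

text \<open>The last entry that is at least \<^term>\<open>a\<close> and precedes \<^term>\<open>b\<close> is followed by a smaller one.\<close>

lemma descent_between:
  assumes A: "flag k A" and a: "a \<in> A i" and b: "b \<in> {1..k + 6}" "b \<notin> A i" "b < a"
  shows "\<exists>m\<in>{3..k + 3}. descent A m \<and> a \<in> A m \<and> b \<notin> A m"
proof -
  let ?M = "{m. a \<in> A m \<and> b \<notin> A m \<and> (\<exists>c\<in>A m - A (m - 1). a \<le> c)}"
  \<comment> \<open>Containing \<open>a\<close> excludes the empty padding, missing \<open>b\<close>
    the full one.\<close>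
  have range: "m \<in> {3..k + 3}" if "a \<in> A m" "b \<notin> A m" for m
    using that flag_empty[OF A, of m] flag_top[OF A, of m] b(1) by force
  then have fin: "finite ?M" by (auto intro: finite_subset[of _ "{3..k + 3}"])
  define p where "p = (LEAST p. a \<in> A p)"
  have p: "a \<in> A p" unfolding p_def using a by (rule LeastI)
  have "p \<le> i" unfolding p_def using a by (rule Least_le)
  then have "b \<notin> A p" using b flag_mono[OF A] by blast
  moreover have "p \<noteq> 0" using p flag_empty[OF A, of 0] by (intro notI) simp
  then have "a \<notin> A (p - 1)" using not_less_Least[of "p - 1" "\<lambda>p. a \<in> A p"] by (simp add: p_def)
  ultimately have "p \<in> ?M" using p by auto
  define m where "m = Max ?M"
  have "m \<in> ?M" unfolding m_def by (rule Max_in[OF fin]) (use \<open>p \<in> ?M\<close> in blast)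
  then have m: "a \<in> A m" "b \<notin> A m" and "\<exists>c\<in>A m - A (m - 1). a \<le> c"
    by simp_all
  then obtain c where c: "c \<in> A m - A (m - 1)" "a \<le> c" by metis
  have mr: "m \<in> {3..k + 3}" using range m by blast
  have "descent A m"
  proof (cases "b \<in> A (Suc m)")
    case True
    then show ?thesis
      unfolding descent_def using c b m(2) by (intro bexI[of _ c] bexI[of _ b]) auto
  next
    case False
    obtain d where d: "d \<in> A (Suc m) - A m" using flag_step_nonempty[OF A, of m] mr by auto
    have "d < a"
    proof (rule ccontr)
      assume "\<not> d < a"
      moreover have "a \<in> A (Suc m)" using m flag_mono[OF A, of m "Suc m"] by auto
      ultimately have "Suc m \<in> ?M" using False d by (auto intro!: bexI[of _ d])
      then have "Suc m \<le> m" unfolding m_def using fin by (rule Max_ge[rotated])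
      then show False by simp
    qed
    then show ?thesis
      unfolding descent_def using c d by (intro bexI[of _ c] bexI[of _ d]) auto
  qed
  then show ?thesis using m mr by blast
qed

text \<open>Since \<open>a\<close> is new at level \<open>i\<close> and \<open>b\<close> enters
  right after it, the exchanged set still lies between its neighbours.\<close>

lemma flag_swap:
  assumes A: "flag k A" and i: "i \<in> {3..k + 3}" and a: "a \<in> A i - A (i - 1)" and b: "b \<in> A (Suc i) - A i"
  shows "flag k (A(i := insert b (A i - {a})))" (is "flag k ?B")
proof -
  have bV: "b \<in> {1..k + 6}" using b flag_subset[OF A] by blast
  have "card (insert b (A i - {a})) = i"
    using a b flag_finite[OF A, of i] flag_card[OF A, of i] i
    by (simp add: card_Diff_singleton_if)
  moreover have "A (i - 1) \<subseteq> insert b (A i - {a})"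
    using a flag_mono[OF A, of "i - 1" i] by auto
  moreover have "insert b (A i - {a}) \<subseteq> A (Suc i)"
    using b flag_mono[OF A, of i "Suc i"] by auto
  ultimately show ?thesis
    using A i bV unfolding flag_def by (auto split: if_splits)
qed

section \<open>The shelling of the maximal chains by element sums\<close>

definition flag_of :: "nat \<Rightarrow> nat set set \<Rightarrow> nat \<Rightarrow> nat set" where
  "flag_of k F = (THE A. flag k A \<and> facet k A = F)"

definition restriction_set :: "nat \<Rightarrow> nat set set \<Rightarrow> nat set set" where
  "restriction_set k F = {flag_of k F i | i. i \<in> {3..k + 3} \<and> descent (flag_of k F) i}"

definition potential :: "nat \<Rightarrow> nat set set \<Rightarrow> nat" where
  "potential k F = (\<Sum>i\<in>{3..k + 3}. \<Sum>(flag_of k F i))"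

lemma flag_of_facet: "flag k A \<Longrightarrow> flag_of k (facet k A) = A"
  unfolding flag_of_def using facet_inj by (intro the_equality) auto

lemma flag_exists: "flag k (\<lambda>i. if i < 3 then {} else if i \<le> k + 3 then {1..i} else {1..k + 6})"
  by (auto simp: flag_def)

lemma potential_shelling_flags:
  "potential_shelling (facet k ` {A. flag k A}) (restriction_set k) (potential k) k"
proof
  have sub: "facet k ` {A. flag k A} \<subseteq> Pow (Pow {1..k + 6})"
    using flag_subset by (fastforce simp: facet_def)
  then show "finite (facet k ` {A. flag k A})"
    by (rule finite_subset) simp
  show "facet k ` {A. flag k A} \<noteq> {}" using flag_exists by blast
  show "card F = Suc k" if "F \<in> facet k ` {A. flag k A}" for F
    using that card_facet by auto
  show "restriction_set k F \<subseteq> F" if "F \<in> facet k ` {A. flag k A}" for F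
    using that by (auto simp: restriction_set_def flag_of_facet) (auto simp: facet_def)
next
  fix F v assume "F \<in> facet k ` {A. flag k A}" and v: "v \<in> restriction_set k F"
  then obtain A where A: "flag k A" "F = facet k A" by auto
  from v obtain i where i: "i \<in> {3..k + 3}" "descent A i" "v = A i"
    by (auto simp: restriction_set_def A flag_of_facet)
  then obtain a b where ab: "a \<in> A i - A (i - 1)" "b \<in> A (Suc i) - A i" "b < a"
    unfolding descent_def by blast
  \<comment> \<open>Exchanging at the descent changes level \<open>i\<close> only and lowers its sum
    by \<open>a - b\<close>.\<close>
  define B where "B = A(i := insert b (A i - {a}))"
  have B: "flag k B" unfolding B_def using flag_swap[OF A(1) i(1) ab(1,2)] .
  have "card (A i) > 0" using ab flag_finite[OF A(1), of i] by (auto simp: card_gt_0_iff)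
  then have lt: "\<Sum>(B i) < \<Sum>(A i)"
    using ab flag_finite[OF A(1), of i] flag_finite[OF B, of i]
    by (intro sum_less_if_differences_less)
       (auto simp: B_def card_Diff_singleton_if card_gt_0_iff)
  have "potential k (facet k B) < potential k F"
    unfolding potential_def A(2) flag_of_facet[OF A(1)] flag_of_facet[OF B]
  proof (rule sum_strict_mono_ex1)
    show "\<forall>j\<in>{3..k + 3}. \<Sum>(B j) \<le> \<Sum>(A j)" using lt by (auto simp: B_def)
    show "\<exists>j\<in>{3..k + 3}. \<Sum>(B j) < \<Sum>(A j)" using lt i by blast
  qed simp
  moreover have "F - {v} \<subseteq> facet k B"
    unfolding A(2) i(3) facet_def B_def by (auto simp: image_iff)
  ultimately show "\<exists>F'\<in>facet k ` {A. flag k A}. potential k F' < potential k F \<and> F - {v} \<subseteq> F'"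
    using B by blast
next
  fix F F' assume "F \<in> facet k ` {A. flag k A}" "F' \<in> facet k ` {A. flag k A}"
    and sub: "restriction_set k F \<subseteq> F'" and ne: "F' \<noteq> F"
  then obtain A B where A: "flag k A" "F = facet k A" and B: "flag k B" "F' = facet k B" by auto
  \<comment> \<open>Where \<open>B\<close> differs from \<open>A\<close> it can only trade elements
    for larger ones: a trade of \<open>a\<close> for a smaller \<open>b\<close> would straddle a
    descent level of \<open>A\<close>, and those levels are shared.\<close>
  have less: "\<Sum>(A i) < \<Sum>(B i)" if i: "i \<in> {3..k + 3}" and AB: "A i \<noteq> B i" for i
  proof (rule sum_less_if_differences_less)
    fix a b assume a: "a \<in> A i - B i" and b: "b \<in> B i - A i"
    show "a < b"
    proof (rule ccontr)
      assume "\<not> a < b"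
      then have "b < a" using a b by (cases "a = b") auto
      moreover have "b \<in> {1..k + 6}" using b flag_subset[OF B(1)] by blast
      ultimately obtain m where m: "m \<in> {3..k + 3}" "descent A m" "a \<in> A m" "b \<notin> A m"
        using descent_between[OF A(1), of a i b] a b by blast
      then have "A m \<in> F'" using sub by (auto simp: restriction_set_def A flag_of_facet)
      then have "A m = B m" using flag_level_in_facet[OF A(1) B(1)] m B(2) by auto
      \<comment> \<open>The common set \<open>A m = B m\<close> contains \<open>a\<close> but not
        \<open>b\<close>: for \<open>m \<le> i\<close> this puts \<open>a\<close> into
        \<open>B i\<close>, otherwise it keeps \<open>b\<close> out of \<open>B i\<close>.\<close>
      then show False using m a b flag_mono[OF B(1), of m i] flag_mono[OF B(1), of i m]
        by (cases "m \<le> i") auto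
    qed
  qed (use i AB flag_finite[OF A(1)] flag_finite[OF B(1)] flag_card[OF A(1)] flag_card[OF B(1)] in auto)
  have "\<exists>i\<in>{3..k + 3}. A i \<noteq> B i" using ne flag_eqI[OF A(1) B(1)] A B by auto
  then have "\<exists>i\<in>{3..k + 3}. \<Sum>(A i) < \<Sum>(B i)" using less by blast
  moreover have "\<Sum>(A i) \<le> \<Sum>(B i)" if "i \<in> {3..k + 3}" for i
    using less[OF that] by (cases "A i = B i") auto
  ultimately show "potential k F < potential k F'"
    unfolding potential_def A(2) B(2) flag_of_facet[OF A(1)] flag_of_facet[OF B(1)]
    by (intro sum_strict_mono_ex1) auto
qed

text \<open>Order the ground set by how few chain members miss an element, breaking ties by value.
  Every chain member is then an initial segment, and the initial segments form a flag.\<close>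

lemma chain_in_flag:
  assumes c: "c \<in> order_complex (middle_sets k)"
  shows "\<exists>A. flag k A \<and> c \<subseteq> facet k A"
proof -
  let ?V = "{1..k + 6}"
  have cP: "c \<subseteq> middle_sets k" and chain: "\<And>E E'. E \<in> c \<Longrightarrow> E' \<in> c \<Longrightarrow> E \<subseteq> E' \<or> E' \<subseteq> E"
    using c by (auto simp: order_complex_def)
  have finc: "finite c" using cP finite_middle_sets finite_subset by blast
  define lev where "lev x = card {E \<in> c. x \<notin> E}" for x
  \<comment> \<open>This encodes the lexicographic order of \<open>(lev x, x)\<close>; the radix
    \<open>k + 7\<close> exceeds every element of the ground set.\<close>
  define key where "key x = lev x * (k + 7) + x" for x
  have mod: "key x mod (k + 7) = x" if "x \<in> ?V" for x
    using that by (simp add: key_def)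
  then have inj: "inj_on key ?V" by (metis inj_onI)
  define A where "A i = (if i < 3 then {} else if i \<le> k + 3
      then {x \<in> ?V. card {y \<in> ?V. key y < key x} < i} else ?V)" for i
  have "card (A i) = i" if "i \<in> {3..k + 3}" for i
    using that card_initial_segment[OF _ inj, of i] by (simp add: A_def)
  then have flag: "flag k A" unfolding flag_def by (auto simp: A_def)
  have "E \<in> facet k A" if E: "E \<in> c" for E
  proof -
    have EV: "E \<subseteq> ?V" and Ec: "3 \<le> card E" "card E \<le> k + 3"
      using E cP by (auto simp: middle_sets_def)
    have finE: "finite E" using EV finite_subset by blast
    have less: "key x < key y" if x: "x \<in> E" and y: "y \<in> ?V" "y \<notin> E" for x y
    proof -
      have "{E' \<in> c. x \<notin> E'} \<subset> {E' \<in> c. y \<notin> E'}" using chain[OF E] x y E by blast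
      then have "lev x < lev y" unfolding lev_def using finc by (intro psubset_card_mono) auto
      then have "Suc (lev x) * (k + 7) \<le> lev y * (k + 7)" by (intro mult_le_mono1) simp
      moreover have "x < k + 7" using x EV by auto
      ultimately show ?thesis unfolding key_def by simp
    qed
    have "card {y \<in> ?V. key y < key x} < card E" if x: "x \<in> E" for x
    proof (rule psubset_card_mono[OF finE])
      show "{y \<in> ?V. key y < key x} \<subset> E" using less[OF x] x by force
    qed
    then have "E \<subseteq> A (card E)" using Ec EV by (auto simp: A_def)
    then have "E = A (card E)"
      using flag_card[OF flag Ec] flag_finite[OF flag] by (intro card_subset_eq) auto
    then show ?thesis using Ec by (auto simp: facet_def)
  qed
  then show ?thesis using flag by blast
qed

lemma order_complex_middle_sets:
  "order_complex (middle_sets k) = {c. c \<noteq> {} \<and> (\<exists>F\<in>facet k ` {A. flag k A}. c \<subseteq> F)}"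
proof (intro equalityI subsetI)
  fix c assume "c \<in> order_complex (middle_sets k)"
  then show "c \<in> {c. c \<noteq> {} \<and> (\<exists>F\<in>facet k ` {A. flag k A}. c \<subseteq> F)}"
    using chain_in_flag by (auto simp: order_complex_def)
next
  fix c assume "c \<in> {c. c \<noteq> {} \<and> (\<exists>F\<in>facet k ` {A. flag k A}. c \<subseteq> F)}"
  then obtain A where A: "flag k A" "c \<subseteq> facet k A" "c \<noteq> {}" by auto
  have "facet k A \<subseteq> middle_sets k"
    using A(1) by (auto simp: facet_def middle_sets_def flag_def)
  moreover have "E \<subseteq> E' \<or> E' \<subseteq> E" if "E \<in> facet k A" "E' \<in> facet k A" for E E'
    using that flag_mono[OF A(1)] unfolding facet_def by (auto, metis nle_le subsetD)
  ultimately show "c \<in> order_complex (middle_sets k)"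
    using A(2,3) unfolding order_complex_def by blast
qed

section \<open>Counting the critical maximal chains\<close>

definition critical_flags :: "nat \<Rightarrow> (nat \<Rightarrow> nat set) set" where
  "critical_flags k = {A. flag k A \<and> (\<forall>i\<in>{3..k + 3}. descent A i)}"

text \<open>The elements outside the bottom set and inside the top set of a critical flag enter in
  decreasing order, so the flag is determined by these two sets.\<close>

definition end_pairs :: "nat \<Rightarrow> (nat set \<times> nat set) set" where
  "end_pairs k = {(B, U). B \<subseteq> U \<and> U \<subseteq> {1..k + 6} \<and> card B = 3 \<and> card U = k + 3 \<and>
     (\<exists>a\<in>B. \<exists>b\<in>{1..k + 6} - U. b < a \<and> (\<forall>x\<in>U - B. b < x \<and> x < a))}"

text \<open>Between the ends each level gains one element, and consecutive descents force these to
  decrease; the witness \<open>a\<close> from the descent at level 3 bounds them all and is kept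
  throughout the induction.\<close>

lemma critical_flag_step:
  assumes "A \<in> critical_flags k" "3 \<le> i" "i \<le> k + 3"
  shows "\<exists>a\<in>A 3. \<exists>b\<in>A (Suc i) - A i. b < a \<and> (\<forall>x\<in>A i - A 3. b < x \<and> x < a)"
  using assms(2,3)
proof (induction i rule: dec_induct)
  case base
  have "descent A 3" using assms(1) base by (auto simp: critical_flags_def)
  then show ?case unfolding descent_def by blast
next
  case (step i)
  have A: "flag k A" using assms(1) by (simp add: critical_flags_def)
  obtain a b where ab: "a \<in> A 3" "b \<in> A (Suc i) - A i" "b < a" "\<forall>x\<in>A i - A 3. b < x \<and> x < a"
    using step by auto
  have ins: "A (Suc i) = insert b (A i)" using flag_step_insert[OF A _ _ ab(2)] step by simp
  have "descent A (Suc i)" using assms(1) step by (auto simp: critical_flags_def)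
  then obtain a' b' where a': "a' \<in> A (Suc i) - A i" and b': "b' \<in> A (Suc (Suc i)) - A (Suc i)" "b' < a'"
    unfolding descent_def by auto
  \<comment> \<open>Level \<open>Suc i\<close> gained only \<open>b\<close>, so its descent compares
    the next entry with \<open>b\<close>.\<close>
  have "a' = b" using a' ins by auto
  then have b'b: "b' < b" using b' by simp
  have "b' < x \<and> x < a" if "x \<in> A (Suc i) - A 3" for x
  proof (cases "x = b")
    case False
    then have "x \<in> A i - A 3" using that ins by simp
    then have "b < x \<and> x < a" using ab(4) by simp
    then show ?thesis using b'b by simp
  qed (use b'b ab(3) in simp)
  moreover have "b' < a" using b'b ab(3) by simp
  ultimately show ?case using ab(1) b'(1) by (intro bexI[of _ a] bexI[of _ b'] conjI ballI) auto
qed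

text \<open>At the step where \<open>y\<close> enters, it is smaller than everything that entered
  since the bottom set, in particular than \<open>x\<close>.\<close>

lemma critical_flag_order:
  assumes "A \<in> critical_flags k" "3 \<le> i" "i \<le> k + 3" "x \<in> A i - A 3" "y \<in> A (k + 3) - A i"
  shows "y < x"
proof -
  have A: "flag k A" using assms(1) by (simp add: critical_flags_def)
  define p where "p = (LEAST p. y \<in> A p)"
  have yk: "y \<in> A (k + 3)" using assms(5) by simp
  have p: "y \<in> A p" unfolding p_def using yk by (rule LeastI)
  have pk: "p \<le> k + 3" unfolding p_def using yk by (rule Least_le)
  have "\<not> p \<le> i" using p assms(5) flag_mono[OF A, of p i] by auto
  then obtain j where j: "p = Suc j" "i \<le> j" by (metis Suc_le_D Suc_le_mono not_less_eq_eq)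
  have "y \<notin> A j" using not_less_Least[of j "\<lambda>p. y \<in> A p"] j by (simp add: p_def)
  obtain b where b: "b \<in> A (Suc j) - A j" "\<forall>x\<in>A j - A 3. b < x"
    using critical_flag_step[OF assms(1), of j] assms j pk by fastforce
  have "A (Suc j) = insert b (A j)" using flag_step_insert[OF A _ _ b(1)] j pk assms by simp
  then have "y = b" using p j \<open>y \<notin> A j\<close> by simp
  moreover have "x \<in> A j - A 3" using assms(4) flag_mono[OF A j(2)] by auto
  ultimately show ?thesis using b by blast
qed

text \<open>If two such flags differed at a level, one would admit \<open>x\<close> before
  \<open>y\<close> and the other \<open>y\<close> before \<open>x\<close>; decreasing entry then
  gives both \<open>y < x\<close> and \<open>x < y\<close>.\<close>

lemma critical_flags_inj: "inj_on (\<lambda>A. (A 3, A (k + 3))) (critical_flags k)"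
proof (rule inj_onI)
  fix A B assume A: "A \<in> critical_flags k" and B: "B \<in> critical_flags k"
    and eq: "(A 3, A (k + 3)) = (B 3, B (k + 3))"
  have fA: "flag k A" and fB: "flag k B" using A B by (auto simp: critical_flags_def)
  show "A = B"
  proof (rule flag_eqI[OF fA fB])
    fix i assume i: "3 \<le> i" "i \<le> k + 3"
    show "A i = B i"
    proof (rule ccontr)
      assume ne: "A i \<noteq> B i"
      have card: "card (A i) = card (B i)" using flag_card[OF fA i] flag_card[OF fB i] by simp
      have "\<not> A i \<subseteq> B i" using ne card flag_finite[OF fB] card_subset_eq by metis
      then obtain x where x: "x \<in> A i" "x \<notin> B i" by blast
      have "\<not> B i \<subseteq> A i" using ne card flag_finite[OF fA] card_subset_eq by metis
      then obtain y where y: "y \<in> B i" "y \<notin> A i" by blast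
      have sub: "A 3 \<subseteq> A i" "B 3 \<subseteq> B i" "A i \<subseteq> A (k + 3)" "B i \<subseteq> B (k + 3)"
        using flag_mono[OF fA] flag_mono[OF fB] i by auto
      have "y < x" using critical_flag_order[OF A i, of x y] x y sub eq by auto
      moreover have "x < y" using critical_flag_order[OF B i, of y x] x y sub eq by auto
      ultimately show False by simp
    qed
  qed
qed

lemma critical_flag_ends:
  assumes "A \<in> critical_flags k"
  shows "(A 3, A (k + 3)) \<in> end_pairs k"
proof -
  have A: "flag k A" using assms by (simp add: critical_flags_def)
  have "A (Suc (k + 3)) = {1..k + 6}" using flag_top[OF A] by simp
  then have "\<exists>a\<in>A 3. \<exists>b\<in>{1..k + 6} - A (k + 3). b < a \<and> (\<forall>x\<in>A (k + 3) - A 3. b < x \<and> x < a)"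
    using critical_flag_step[OF assms, of "k + 3"] by simp
  then show ?thesis
    unfolding end_pairs_def
    using flag_card[OF A, of 3] flag_card[OF A, of "k + 3"] flag_subset[OF A, of "k + 3"]
      flag_mono[OF A, of 3 "k + 3"] by simp
qed

text \<open>The flag is rebuilt by adding the elements of \<open>U - B\<close> to \<open>B\<close>
  in decreasing order.\<close>

lemma end_pair_from_critical_flag:
  assumes "(B, U) \<in> end_pairs k"
  shows "\<exists>A\<in>critical_flags k. A 3 = B \<and> A (k + 3) = U"
proof -
  have BU: "B \<subseteq> U" "U \<subseteq> {1..k + 6}" "card B = 3" "card U = k + 3"
    using assms by (auto simp: end_pairs_def)
  obtain a b where a: "a \<in> B" and b: "b \<in> {1..k + 6} - U" and ba: "b < a"
    and between: "\<And>x. x \<in> U - B \<Longrightarrow> b < x \<and> x < a"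
    using assms unfolding end_pairs_def by blast
  let ?M = "U - B"
  have finU: "finite U" using finite_subset[OF BU(2)] by simp
  then have finB: "finite B" using finite_subset[OF BU(1)] by simp
  have cardM: "card ?M = k" using BU finU finB by (simp add: card_Diff_subset)
  \<comment> \<open>The negated keys make the rank count larger elements, so \<open>top j\<close>
    consists of the \<open>j\<close> largest elements of \<open>U - B\<close>.\<close>
  define rank where "rank x = card {y \<in> ?M. - int y < - int x}" for x
  define top where "top j = {x \<in> ?M. rank x < j}" for j
  have card_top: "card (top j) = j" if "j \<le> k" for j
    unfolding top_def rank_def using finU cardM that
    by (intro card_initial_segment) (auto intro: inj_onI)
  have top_less: "x < y" if "x \<in> top (Suc j) - top j" "y \<in> top j" for x y j
  proof (rule ccontr)
    assume "\<not> x < y"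
    then have "rank x \<le> rank y" unfolding rank_def using finU by (intro card_mono) auto
    then show False using that by (auto simp: top_def)
  qed
  have top_step: "top (Suc j) - top j \<noteq> {}" if "Suc j \<le> k" for j
  proof
    assume "top (Suc j) - top j = {}"
    then have "card (top (Suc j)) \<le> card (top j)"
      using finU by (intro card_mono) (auto simp: top_def)
    then show False using card_top[of j] card_top[of "Suc j"] that by simp
  qed
  have topM: "top k = ?M"
    using card_top[of k] cardM finU by (intro card_subset_eq) (auto simp: top_def)
  define A where "A i = (if i < 3 then {} else if i \<le> k + 3 then B \<union> top (i - 3) else {1..k + 6})" for i
  have top_sub: "top j \<subseteq> ?M" for j by (auto simp: top_def)
  have fin_top: "finite (top j)" for j using finU finite_subset[OF top_sub] by blast
  have top_mono: "top i \<subseteq> top j" if "i \<le> j" for i j using that by (auto simp: top_def)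
  have top0: "top 0 = {}" by (simp add: top_def)
  have A3: "A 3 = B" by (simp add: A_def top0)
  have Ak: "A (k + 3) = U" using BU by (auto simp: A_def topM)
  have "card (A i) = i" if "i \<in> {3..k + 3}" for i
  proof -
    have "card (B \<union> top (i - 3)) = card B + card (top (i - 3))"
      using finB fin_top top_sub by (intro card_Un_disjoint) auto
    moreover have "i - 3 \<le> k" using that by auto
    ultimately show ?thesis using that BU card_top[of "i - 3"] by (simp add: A_def)
  qed
  moreover have "A i \<subseteq> {1..k + 6}" for i
    using BU top_sub[of "i - 3"] by (auto simp: A_def)
  moreover have "A i \<subseteq> A (Suc i)" for i
  proof -
    have "top (i - 3) \<subseteq> top (Suc i - 3)" by (rule top_mono) arith
    then show ?thesis using calculation(2)[of i] by (auto simp: A_def)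
  qed
  moreover have "\<forall>i<3. A i = {}" "\<forall>i>k + 3. A i = {1..k + 6}" by (auto simp: A_def)
  ultimately have flag: "flag k A" unfolding flag_def by blast
  have "descent A i" if i: "i \<in> {3..k + 3}" for i
  proof -
    \<comment> \<open>The smaller element of the descent is the next one of \<open>U - B\<close>, or
      \<open>b\<close> once \<open>U\<close> is reached.\<close>
    have lower: "\<exists>b'\<in>A (Suc i) - A i. b' = b \<or> b' \<in> top (Suc (i - 3)) - top (i - 3)"
    proof (cases "i = k + 3")
      case True
      then show ?thesis using b Ak by (auto simp: A_def)
    next
      case False
      then have "Suc (i - 3) \<le> k" using i by auto
      then obtain b' where b': "b' \<in> top (Suc (i - 3)) - top (i - 3)" using top_step[of "i - 3"] by blast
      then have "b' \<in> A (Suc i)" "b' \<notin> A i"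
      proof -
        have "Suc (i - 3) = i - 2" using i by auto
        then have "b' \<in> top (i - 2) - top (i - 3)" using b' by simp
        then show "b' \<in> A (Suc i)" "b' \<notin> A i"
          using i False top_sub[of "i - 2"] by (auto simp: A_def)
      qed
      then show ?thesis using b' by blast
    qed
    show ?thesis
    proof (cases "i = 3")
      case True
      have "a \<in> A i - A (i - 1)" using a True by (simp add: A_def)
      moreover obtain b' where "b' \<in> A (Suc i) - A i" "b' = b \<or> b' \<in> top (Suc (i - 3)) - top (i - 3)"
        using lower by blast
      moreover have "b' < a" using calculation(3) ba between[of b'] top_sub by blast
      ultimately show ?thesis unfolding descent_def by blast
    next
      case False
      \<comment> \<open>Level \<open>i\<close> is now \<open>B\<close> together with
        \<open>top (Suc j)\<close>, and \<open>a'\<close> is its latest entry.\<close>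
      define j where "j = i - 4"
      have ij: "i = j + 4" using False i by (simp add: j_def)
      obtain a' where a': "a' \<in> top (Suc j) - top j" using top_step[of j] ij i by auto
      then have aA: "a' \<in> A i - A (i - 1)"
        using ij i top_sub[of "Suc j"] by (auto simp: A_def)
      obtain b' where b': "b' \<in> A (Suc i) - A i" "b' = b \<or> b' \<in> top (Suc (Suc j)) - top (Suc j)"
        using lower by (auto simp: ij)
      have "b' < a'"
        using b'(2)
      proof
        assume "b' = b"
        then show ?thesis using between[of a'] a' top_sub by blast
      next
        assume "b' \<in> top (Suc (Suc j)) - top (Suc j)"
        then show ?thesis using top_less[of b' "Suc j" a'] a' by blast
      qed
      then show ?thesis unfolding descent_def using aA b' by blast
    qed
  qed
  then show ?thesis using flag A3 Ak by (auto simp: critical_flags_def)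
qed

lemma card_critical_flags_end_pairs: "card (critical_flags k) = card (end_pairs k)"
proof (rule bij_betw_same_card[of "\<lambda>A. (A 3, A (k + 3))"])
  show "bij_betw (\<lambda>A. (A 3, A (k + 3))) (critical_flags k) (end_pairs k)"
    unfolding bij_betw_def
    using critical_flags_inj critical_flag_ends end_pair_from_critical_flag by (fastforce simp: image_iff)
qed

text \<open>In an end pair the elements above the largest element \<^term>\<open>k + 6 - r\<close> of the bottom set all lie
  outside the top set, and so does the least remaining one; hence \<^term>\<open>r < 3\<close>.\<close>

definition end_codes :: "nat \<Rightarrow> (nat \<times> nat set \<times> nat set) set" where
  "end_codes k = (SIGMA r:{..<3}. SIGMA X:{X. X \<subseteq> {1..k + 5 - r} \<and> card X = 2}.
     {Z. Z \<subseteq> {1..k + 5 - r} - X - {Min ({1..k + 5 - r} - X)} \<and> card Z = 2 - r})"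

text \<open>\<open>k + 6 - r\<close> is the maximum of the bottom set and \<open>X\<close> its
  remainder. Outside the top set lie the \<open>r\<close> elements above this maximum, the least
  element below it that is not in \<open>X\<close>, and \<open>Z\<close>; three in all, whence
  \<open>card Z = 2 - r\<close>.\<close>

definition decode :: "nat \<Rightarrow> nat \<times> nat set \<times> nat set \<Rightarrow> nat set \<times> nat set" where
  "decode k = (\<lambda>(r, X, Z). (insert (k + 6 - r) X,
     {1..k + 6 - r} - insert (Min ({1..k + 5 - r} - X)) Z))"

lemma end_codesD:
  assumes "(r, X, Z) \<in> end_codes k"
  shows "r < 3" "X \<subseteq> {1..k + 5 - r}" "card X = 2"
    "Min ({1..k + 5 - r} - X) \<in> {1..k + 5 - r} - X" "\<And>y. y \<in> {1..k + 5 - r} - X \<Longrightarrow> Min ({1..k + 5 - r} - X) \<le> y"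
    "Z \<subseteq> {1..k + 5 - r} - X - {Min ({1..k + 5 - r} - X)}" "card Z = 2 - r"
proof -
  show X: "r < 3" "X \<subseteq> {1..k + 5 - r}" "card X = 2"
    and "Z \<subseteq> {1..k + 5 - r} - X - {Min ({1..k + 5 - r} - X)}" "card Z = 2 - r"
    using assms by (auto simp: end_codes_def)
  have "card ({1..k + 5 - r} - X) = k + 5 - r - 2"
    using X finite_subset[of X "{1..k + 5 - r}"] by (simp add: card_Diff_subset)
  then have "card ({1..k + 5 - r} - X) > 0" using X by simp
  then have "{1..k + 5 - r} - X \<noteq> {}" by (metis card.empty less_irrefl)
  then show "Min ({1..k + 5 - r} - X) \<in> {1..k + 5 - r} - X"
    by (intro Min_in) auto
  show "Min ({1..k + 5 - r} - X) \<le> y" if "y \<in> {1..k + 5 - r} - X" for y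
    using that by (intro Min_le) auto
qed

lemma end_codes_top:
  assumes "(r, X, Z) \<in> end_codes k"
  shows "k + 6 - r \<notin> X"
proof
  assume "k + 6 - r \<in> X"
  then have "k + 6 - r \<in> {1..k + 5 - r}" using end_codesD(2)[OF assms] by blast
  then show False using end_codesD(1)[OF assms] unfolding atLeastAtMost_iff by linarith
qed

text \<open>The maximum of the bottom set and the least removed element serve as the witnesses
  \<open>a\<close> and \<open>b\<close> of an end pair.\<close>

lemma decode_in:
  assumes "c \<in> end_codes k"
  shows "decode k c \<in> end_pairs k"
proof -
  obtain r X Z where c: "c = (r, X, Z)" by (cases c)
  note D = end_codesD[OF assms[unfolded c]]
  let ?b = "Min ({1..k + 5 - r} - X)" and ?a = "k + 6 - r"
  let ?U = "{1..?a} - insert ?b Z"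
  have fin: "finite X" "finite Z" using D(2,6) by (auto intro: finite_subset)
  have aX: "?a \<notin> X" using end_codes_top[OF assms[unfolded c]] .
  have card_B: "card (insert ?a X) = 3" using D(3) aX fin by simp
  have sub: "insert ?b Z \<subseteq> {1..?a}" using D(4,6) by auto
  have bZ: "?b \<notin> Z" using D(6) by auto
  have "card ?U = ?a - Suc (2 - r)"
    using sub fin D(7) bZ by (simp add: card_Diff_subset)
  then have card_U: "card ?U = k + 3" using D(1) by simp
  have BU: "insert ?a X \<subseteq> ?U"
  proof -
    have "?a \<notin> {1..k + 5 - r}" using D(1) unfolding atLeastAtMost_iff by linarith
    moreover have "?b \<in> {1..k + 5 - r}" "?b \<notin> X" using D(4) by simp_all
    moreover have "Z \<subseteq> {1..k + 5 - r}" "Z \<inter> X = {}" using D(6) by blast+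
    ultimately have "insert ?a X \<inter> insert ?b Z = {}"
      by (metis (no_types, lifting) Int_commute Int_insert_left_if0 insert_iff subsetD)
    moreover have "{1..k + 5 - r} \<subseteq> {1..?a}" "?a \<in> {1..?a}" using D(1) by auto
    then have "insert ?a X \<subseteq> {1..?a}" using D(2) by blast
    ultimately show ?thesis by blast
  qed
  have UV: "?U \<subseteq> {1..k + 6}" by auto
  have b: "?b \<in> {1..k + 6} - ?U" "?b < ?a" using D(1,4) by auto
  have between: "?b < x \<and> x < ?a" if x: "x \<in> ?U - insert ?a X" for x
  proof -
    have "x \<in> {1..k + 5 - r} - X" "x \<noteq> ?b" using x by auto
    then have "?b < x" using D(5)[of x] by linarith
    moreover have "x < ?a" using \<open>x \<in> {1..k + 5 - r} - X\<close> D(1) by auto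
    ultimately show ?thesis ..
  qed
  have "\<exists>a\<in>insert ?a X. \<exists>b\<in>{1..k + 6} - ?U. b < a \<and> (\<forall>x\<in>?U - insert ?a X. b < x \<and> x < a)"
    by (rule bexI[of _ ?a], rule bexI[of _ ?b]) (use b between in simp_all)
  then show ?thesis
    unfolding c decode_def end_pairs_def using card_B card_U BU UV by simp
qed

text \<open>The maximum of the bottom set gives back \<open>r\<close>, the rest of it
  \<open>X\<close>; these fix the removed minimum, and complementing the top set leaves
  \<open>Z\<close>.\<close>

lemma decode_inj: "inj_on (decode k) (end_codes k)"
proof (rule inj_onI)
  fix c c' assume c: "c \<in> end_codes k" "c' \<in> end_codes k" and eq: "decode k c = decode k c'"
  obtain r X Z r' X' Z' where cc: "c = (r, X, Z)" "c' = (r', X', Z')" by (metis prod_cases3)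
  note D = end_codesD[OF c(1)[unfolded cc]] and D' = end_codesD[OF c(2)[unfolded cc]]
  have eq1: "insert (k + 6 - r) X = insert (k + 6 - r') X'"
    and eq2: "{1..k + 6 - r} - insert (Min ({1..k + 5 - r} - X)) Z
      = {1..k + 6 - r'} - insert (Min ({1..k + 5 - r'} - X')) Z'"
    using eq by (auto simp: cc decode_def)
  have fin: "finite X" "finite X'" using D(2) D'(2) by (auto intro: finite_subset)
  have "Max (insert (k + 6 - r) X) = k + 6 - r" "Max (insert (k + 6 - r') X') = k + 6 - r'"
    using D(2) D'(2) fin by (intro Max_eqI; force)+
  then have r: "r = r'" using eq1 D(1) D'(1) by simp
  have X: "X = X'"
    using end_codes_top[OF c(1)[unfolded cc]] end_codes_top[OF c(2)[unfolded cc]] eq1 r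
    by (metis insert_ident)
  let ?V = "{1..k + 6 - r}" and ?b = "Min ({1..k + 5 - r} - X)"
  have "insert ?b Z = ?V - (?V - insert ?b Z)" "insert ?b Z' = ?V - (?V - insert ?b Z')"
    using D(4,6) D'(4,6) r X by auto
  then have "insert ?b Z = insert ?b Z'" using eq2 r X by simp
  moreover have "?b \<notin> Z" "?b \<notin> Z'" using D(6) D'(6) r X by auto
  ultimately have "Z = Z'" by (metis insert_ident)
  then show "c = c'" using cc r X by simp
qed

text \<open>Arbitrary witnesses can be replaced by extremal ones: all of \<open>U\<close> is at most
  \<open>m = Max B\<close>, and the least element below \<open>m\<close> outside \<open>X\<close> is
  at most \<open>b\<close>, hence below all of \<open>U - B\<close> and so outside
  \<open>U\<close>.\<close>

lemma decode_surj:
  assumes "(B, U) \<in> end_pairs k"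
  shows "\<exists>c\<in>end_codes k. decode k c = (B, U)"
proof -
  have BU: "B \<subseteq> U" "U \<subseteq> {1..k + 6}" "card B = 3" "card U = k + 3"
    using assms by (auto simp: end_pairs_def)
  obtain a b where aB: "a \<in> B" and b: "b \<in> {1..k + 6} - U" and ba: "b < a"
    and between: "\<And>x. x \<in> U - B \<Longrightarrow> b < x \<and> x < a"
    using assms unfolding end_pairs_def by blast
  have finU: "finite U" using finite_subset[OF BU(2)] by simp
  then have finB: "finite B" using finite_subset[OF BU(1)] by simp
  define m where "m = Max B"
  have m: "m \<in> B" "\<And>x. x \<in> B \<Longrightarrow> x \<le> m"
    unfolding m_def using finB aB by (auto intro!: Max_in)
  define W where "W = {1..k + 6} - U"
  have finW: "finite W" and cardW: "card W = 3"
    using BU finU by (simp_all add: W_def card_Diff_subset)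
  have mV: "m \<in> {1..k + 6}" using m BU by auto
  have U_le: "x \<le> m" if "x \<in> U" for x
    using that between[of x] m(2)[of x] m(2)[OF aB] by (cases "x \<in> B") auto
  define r where "r = k + 6 - m"
  have mr: "m = k + 6 - r" "m - 1 = k + 5 - r" using mV by (auto simp: r_def)
  have above: "{m<..k + 6} \<subseteq> W" using U_le unfolding W_def by force
  have "b < m" using ba m(2)[OF aB] by simp
  have bW: "b \<in> W" using b by (simp add: W_def)
  \<comment> \<open>The three-element set \<open>W\<close> contains the \<open>r\<close> elements
    above \<open>m\<close> and also \<open>b\<close>, which lies below \<open>m\<close>.\<close>
  have "card (insert b {m<..k + 6}) \<le> card W"
    using above bW finW by (intro card_mono) auto
  then have r3: "r < 3" using cardW \<open>b < m\<close> by (simp add: r_def)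
  define X where "X = B - {m}"
  have X: "X \<subseteq> {1..k + 5 - r}" "card X = 2"
  proof -
    show "card X = 2" using m finB BU by (simp add: X_def)
    show "X \<subseteq> {1..k + 5 - r}"
    proof
      fix x assume x: "x \<in> X"
      then have "x \<le> m" "x \<noteq> m" "1 \<le> x" using m(2) BU by (auto simp: X_def)
      then show "x \<in> {1..k + 5 - r}" using mr by auto
    qed
  qed
  let ?V = "{1..k + 5 - r}"
  define Y where "Y = W \<inter> ?V"
  have VX: "?V - X = (U - B) \<union> Y"
  proof (intro equalityI subsetI)
    fix x assume x: "x \<in> ?V - X"
    then have "x \<in> {1..k + 6}" "x \<noteq> m" using mr mV by auto
    then show "x \<in> (U - B) \<union> Y" using x by (auto simp: X_def Y_def W_def)
  next
    fix x assume "x \<in> (U - B) \<union> Y"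
    then show "x \<in> ?V - X"
    proof
      assume x: "x \<in> U - B"
      then have "x \<le> m" "x \<noteq> m" "1 \<le> x" using U_le m BU by auto
      then show ?thesis using x mr by (auto simp: X_def)
    next
      assume "x \<in> Y"
      then show ?thesis using BU by (auto simp: Y_def W_def X_def)
    qed
  qed
  have bY: "b \<in> Y" using bW b \<open>b < m\<close> mr by (auto simp: Y_def)
  have fin: "finite (?V - X)" "finite Y" by (simp_all add: Y_def)
  have ne: "?V - X \<noteq> {}" using bY VX by blast
  define \<mu> where "\<mu> = Min (?V - X)"
  have \<mu>: "\<mu> \<in> ?V - X" "\<mu> \<le> b"
    unfolding \<mu>_def using Min_in[OF fin(1) ne] Min_le[OF fin(1), of b] bY VX by blast+
  have "\<mu> \<notin> U - B" using \<mu>(2) between[of \<mu>] by auto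
  then have \<mu>Y: "\<mu> \<in> Y" using \<mu>(1) VX by blast
  have W_eq: "W = {m<..k + 6} \<union> Y"
  proof (intro equalityI subsetI)
    fix x assume x: "x \<in> W"
    then have "x \<noteq> m" using m BU by (auto simp: W_def)
    then show "x \<in> {m<..k + 6} \<union> Y" using x mr by (auto simp: Y_def W_def)
  qed (use above in \<open>auto simp: Y_def\<close>)
  have "card W = card {m<..k + 6} + card Y"
    unfolding W_eq using fin mr by (intro card_Un_disjoint) (auto simp: Y_def)
  then have cardY: "card Y = 3 - r" using cardW by (simp add: r_def)
  define Z where "Z = Y - {\<mu>}"
  have "card Z = 2 - r" using cardY \<mu>Y fin by (simp add: Z_def)
  moreover have "Z \<subseteq> ?V - X - {\<mu>}" unfolding VX Z_def by blast
  ultimately have "(r, X, Z) \<in> end_codes k"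
    using r3 X by (simp add: end_codes_def \<mu>_def)
  moreover have "decode k (r, X, Z) = (B, U)"
  proof -
    have "insert m X = B" using m by (auto simp: X_def)
    moreover have "insert \<mu> Z = Y" using \<mu>Y by (auto simp: Z_def)
    moreover have "{1..m} - Y = U"
    proof (intro equalityI subsetI)
      fix x assume "x \<in> {1..m} - Y"
      then have "x \<in> {1..k + 6}" "x \<notin> W" using W_eq mV by auto
      then show "x \<in> U" by (auto simp: W_def)
    next
      fix x assume "x \<in> U"
      then show "x \<in> {1..m} - Y" using U_le BU by (auto simp: Y_def W_def)
    qed
    ultimately show ?thesis by (simp only: decode_def prod.case mr(1)[symmetric] \<mu>_def[symmetric])
  qed
  ultimately show ?thesis by blast
qed

text \<open>After the choice of \<open>X\<close>, \<open>k + 3 - r\<close> elements below the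
  maximum remain; their minimum is forced out, and \<open>Z\<close> is chosen among the other
  \<open>k + 2 - r\<close>.\<close>

lemma card_end_codes:
  "card (end_codes k) = (\<Sum>r<3. (k + 5 - r choose 2) * (k + 2 - r choose (2 - r)))"
proof -
  let ?V = "\<lambda>r. {1..k + 5 - r}"
  let ?X = "\<lambda>r. {X. X \<subseteq> ?V r \<and> card X = 2}"
  let ?Z = "\<lambda>r X. {Z. Z \<subseteq> ?V r - X - {Min (?V r - X)} \<and> card Z = 2 - r}"
  have finX: "finite (?X r)" for r
    by (rule finite_subset[of _ "Pow (?V r)"]) auto
  have finZ: "finite (?Z r X)" for r X
    by (rule finite_subset[of _ "Pow (?V r)"]) auto
  have cardZ: "card (?Z r X) = (k + 2 - r choose (2 - r))" if "r < 3" "X \<in> ?X r" for r X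
  proof -
    have "finite X" using that by (auto intro: finite_subset)
    then have c: "card (?V r - X) = k + 5 - r - 2" using that by (simp add: card_Diff_subset)
    then have "card (?V r - X) > 0" using that by simp
    then have "?V r - X \<noteq> {}" by (metis card.empty less_irrefl)
    then have "Min (?V r - X) \<in> ?V r - X" by (intro Min_in) auto
    then have "card (?V r - X - {Min (?V r - X)}) = k + 2 - r"
      using c by (simp add: card_Diff_singleton)
    then show ?thesis by (simp add: n_subsets)
  qed
  have "card (end_codes k) = (\<Sum>r<3. card (SIGMA X:?X r. ?Z r X))"
    unfolding end_codes_def using finX finZ by (intro card_SigmaI) auto
  also have "\<dots> = (\<Sum>r<3. \<Sum>X\<in>?X r. card (?Z r X))"
    using finX finZ by (intro sum.cong refl card_SigmaI) auto
  also have "\<dots> = (\<Sum>r<3. \<Sum>X\<in>?X r. (k + 2 - r choose (2 - r)))"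
    using cardZ by (intro sum.cong refl) auto
  also have "\<dots> = (\<Sum>r<3. (k + 5 - r choose 2) * (k + 2 - r choose (2 - r)))"
    by (simp add: n_subsets)
  finally show ?thesis .
qed

lemma two_times_choose_two: "2 * (n choose 2) = n * (n - 1)"
  by (cases n) (simp_all add: choose_two)

theorem card_critical_flags:
  "card (critical_flags k) = (k + 1) * (k + 3) * (k + 4) * (k + 6) div 4 + 1"
proof -
  have "card (critical_flags k) = card (end_codes k)"
    unfolding card_critical_flags_end_pairs
  proof (rule bij_betw_same_card[symmetric, of "decode k"])
    show "bij_betw (decode k) (end_codes k) (end_pairs k)"
      unfolding bij_betw_def
    proof (intro conjI equalityI subsetI)
      fix p assume "p \<in> end_pairs k"
      then show "p \<in> decode k ` end_codes k" using decode_surj[of "fst p" "snd p" k] by force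
    qed (use decode_inj decode_in in auto)
  qed
  also have "\<dots> = (k + 5 choose 2) * (k + 2 choose 2) + (k + 4 choose 2) * (k + 1) + (k + 3 choose 2)"
  proof -
    have "{..<3::nat} = {0, 1, 2}" by auto
    then show ?thesis unfolding card_end_codes by (simp add: algebra_simps)
  qed
  finally have count: "card (critical_flags k) =
      (k + 5 choose 2) * (k + 2 choose 2) + (k + 4 choose 2) * (k + 1) + (k + 3 choose 2)" .
  have choose: "2 * (k + 5 choose 2) = (k + 5) * (k + 4)" "2 * (k + 4 choose 2) = (k + 4) * (k + 3)"
    "2 * (k + 3 choose 2) = (k + 3) * (k + 2)" "2 * (k + 2 choose 2) = (k + 2) * (k + 1)"
    unfolding two_times_choose_two by simp_all
  \<comment> \<open>The factor 4 clears the denominators of the binomial coefficients; the constant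
    4 left over is the \<open>+ 1\<close> of the count.\<close>
  have "4 * card (critical_flags k) = (2 * (k + 5 choose 2)) * (2 * (k + 2 choose 2))
      + 2 * (k + 1) * (2 * (k + 4 choose 2)) + 2 * (2 * (k + 3 choose 2))"
    unfolding count by (simp add: algebra_simps)
  also have "\<dots> = (k + 1) * (k + 3) * (k + 4) * (k + 6) + 4"
    unfolding choose by (simp add: algebra_simps)
  finally show ?thesis by simp
qed

section \<open>Neighborhood complexes of Kneser graphs\<close>

context potential_shelling begin

lemma faces_homotopy_equivalent_sphere_wedge:
  assumes "critical \<noteq> {}"
  shows "top_of_set (underlying_set (faces \<F>)) homotopy_equivalent_space
    sphere_wedge (card critical) k"
proof -
  have crit: "critical \<subseteq> \<F>" by (auto simp: critical_def)
  interpret cells: attached_cells "faces \<F> - critical" critical k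
  proof
    show "finite critical" using fin finite_subset[OF crit] by simp
    show "c \<in> faces \<F> - critical" if F: "F \<in> critical" and c: "c \<subset> F" "c \<noteq> {}" for F c
    proof -
      have FF: "F \<in> \<F>" using F crit by blast
      then have "c \<in> faces \<F>" using c unfolding faces_def by blast
      moreover have "c \<notin> critical" using subset_facet_eq[of c F] FF c crit by blast
      ultimately show ?thesis by simp
    qed
  qed (use assms crit card_facet simplicial_complex_faces(2)[of \<F>] noncritical_nonempty
      contractible_faces_minus_critical in auto)
  have "critical \<subseteq> faces \<F>" using crit facet_nonempty unfolding faces_def by blast
  then have "faces \<F> - critical \<union> critical = faces \<F>" by blast
  then show ?thesis using cells.homotopy_equivalent_sphere_wedge by simp
qed

end

lemma neighborhood_complex_kneser_graph:
  "neighborhood_complex (kneser_graph 3 k) = union_complex (kneser_verts 3 k) (middle_sets k)"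
proof (intro equalityI subsetI)
  let ?V = "{1..k + 6}"
  fix S assume "S \<in> neighborhood_complex (kneser_graph 3 k)"
  then obtain w where S: "S \<noteq> {}" "S \<subseteq> kneser_verts 3 k" and w: "w \<in> kneser_verts 3 k"
    and disj: "\<And>v. v \<in> S \<Longrightarrow> v \<inter> w = {}"
    unfolding neighborhood_complex_def adjacent_kneser_graph by (auto simp: kneser_graph_def)
  have wV: "w \<subseteq> ?V" "card w = 3" using w by (auto simp: kneser_verts_def)
  have "v \<subseteq> ?V - w" if "v \<in> S" for v
    using that S(2) disj[OF that] by (auto simp: kneser_verts_def add.commute)
  then have U: "\<Union>S \<subseteq> ?V - w" by (rule Union_least)
  have "card (?V - w) = k + 3"
    using wV finite_subset[OF wV(1)] by (simp add: card_Diff_subset)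
  then have "card (\<Union>S) \<le> k + 3" using card_mono[OF _ U] by simp
  moreover obtain v where v: "v \<in> S" using S by blast
  have "card v \<le> card (\<Union>S)"
    using v finite_subset[OF U] by (intro card_mono) auto
  then have "3 \<le> card (\<Union>S)" using v S by (auto simp: kneser_verts_def)
  ultimately show "S \<in> union_complex (kneser_verts 3 k) (middle_sets k)"
    using S U by (auto simp: union_complex_def middle_sets_def)
next
  let ?V = "{1..k + 6}"
  fix S assume "S \<in> union_complex (kneser_verts 3 k) (middle_sets k)"
  then have S: "S \<noteq> {}" "S \<subseteq> kneser_verts 3 k" and U: "\<Union>S \<subseteq> ?V" "card (\<Union>S) \<le> k + 3"
    by (auto simp: union_complex_def middle_sets_def)
  have "card (?V - \<Union>S) = k + 6 - card (\<Union>S)"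
    using U finite_subset[OF U(1)] by (simp add: card_Diff_subset)
  then have "3 \<le> card (?V - \<Union>S)" using U(2) by simp
  then obtain w where w: "w \<subseteq> ?V - \<Union>S" "card w = 3"
    using obtain_subset_with_card_n by metis
  then have "w \<in> kneser_verts 3 k" by (auto simp: kneser_verts_def)
  moreover have "v \<inter> w = {}" if "v \<in> S" for v using w that by blast
  moreover have "finite S" using finite_subset[OF S(2) finite_kneser_verts] .
  ultimately show "S \<in> neighborhood_complex (kneser_graph 3 k)"
    using S unfolding neighborhood_complex_def
    by (auto simp: adjacent_kneser_graph) (auto simp: kneser_graph_def)
qed

lemma generated_family_middle_sets: "generated_family (kneser_verts 3 k) (middle_sets k)"
proof
  show "finite (kneser_verts 3 k)" by (rule finite_kneser_verts)
  show "finite (middle_sets k)" by (rule finite_middle_sets)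
  show "finite A \<and> A \<noteq> {}" if "A \<in> middle_sets k" for A
    using that finite_subset[of A "{1..k + 6}"] by (auto simp: middle_sets_def)
  show "\<Union>{B \<in> kneser_verts 3 k. B \<subseteq> A} = A" if A: "A \<in> middle_sets k" for A
  proof
    show "A \<subseteq> \<Union>{B \<in> kneser_verts 3 k. B \<subseteq> A}"
    proof
      fix a assume a: "a \<in> A"
      have AV: "A \<subseteq> {1..k + 6}" "3 \<le> card A" using A by (auto simp: middle_sets_def)
      have "card (A - {a}) = card A - 1" using a by simp
      then have "2 \<le> card (A - {a})" using AV(2) by simp
      then obtain C where C: "C \<subseteq> A - {a}" "card C = 2" "finite C"
        using obtain_subset_with_card_n by metis
      have "a \<notin> C" using C(1) by blast
      then have "card (insert a C) = 3" using C by simp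
      then have "insert a C \<in> kneser_verts 3 k" "insert a C \<subseteq> A"
        using C(1) a AV(1) by (auto simp: kneser_verts_def)
      then show "a \<in> \<Union>{B \<in> kneser_verts 3 k. B \<subseteq> A}" by blast
    qed
  qed blast
  show "\<Union>S \<in> middle_sets k"
    if A: "A \<in> middle_sets k" and S: "S \<subseteq> {B \<in> kneser_verts 3 k. B \<subseteq> A}" "S \<noteq> {}" for A S
  proof -
    have AV: "A \<subseteq> {1..k + 6}" "card A \<le> k + 3" using A by (auto simp: middle_sets_def)
    have finA: "finite A" using finite_subset[OF AV(1)] by simp
    have U: "\<Union>S \<subseteq> A" using S by blast
    have "card (\<Union>S) \<le> card A" using card_mono[OF finA U] .
    moreover obtain B where B: "B \<in> S" using S by blast
    have "card B \<le> card (\<Union>S)"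
      using B finite_subset[OF U finA] by (intro card_mono) auto
    then have "3 \<le> card (\<Union>S)" using B S by (auto simp: kneser_verts_def)
    ultimately show ?thesis using AV U by (auto simp: middle_sets_def)
  qed
qed

theorem theorem1p3:
  fixes k :: nat
  shows "geometric_realization (neighborhood_complex (kneser_graph 3 k))
    homotopy_equivalent_space
    sphere_wedge ((k + 1) * (k + 3) * (k + 4) * (k + 6) div 4 + 1) k"
proof -
  interpret gen: generated_family "kneser_verts 3 k" "middle_sets k"
    by (rule generated_family_middle_sets)
  interpret shell: potential_shelling "facet k ` {A. flag k A}" "restriction_set k" "potential k" k
    by (rule potential_shelling_flags)
  have faces: "shell.faces (facet k ` {A. flag k A}) = order_complex (middle_sets k)"
    by (simp add: shell.faces_def order_complex_middle_sets)
  \<comment> \<open>The levels of a flag are pairwise distinct sets, so a facet equals its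
    restriction set only if every level is a descent.\<close>
  have "restriction_set k (facet k A) = facet k A \<longleftrightarrow> (\<forall>i\<in>{3..k + 3}. descent A i)"
    if A: "flag k A" for A
  proof -
    have "restriction_set k (facet k A) = A ` {i \<in> {3..k + 3}. descent A i}"
      by (auto simp: restriction_set_def flag_of_facet[OF A])
    then have "restriction_set k (facet k A) = facet k A \<longleftrightarrow>
        {i \<in> {3..k + 3}. descent A i} = {3..k + 3}"
      unfolding facet_def
      by (simp only:) (rule inj_on_image_eq_iff[OF flag_inj_on[OF A]]; blast)
    then show ?thesis by blast
  qed
  then have "shell.critical = facet k ` critical_flags k"
    by (auto simp: shell.critical_def critical_flags_def)
  moreover have "inj_on (facet k) (critical_flags k)"
    by (rule inj_onI) (auto simp: critical_flags_def intro: facet_inj)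
  ultimately have card: "card shell.critical = (k + 1) * (k + 3) * (k + 4) * (k + 6) div 4 + 1"
    by (simp add: card_image card_critical_flags)
  \<comment> \<open>The summand 1 in the count guarantees a cell to attach.\<close>
  then have "shell.critical \<noteq> {}" by auto
  then have "top_of_set (underlying_set (order_complex (middle_sets k))) homotopy_equivalent_space
      sphere_wedge ((k + 1) * (k + 3) * (k + 4) * (k + 6) div 4 + 1) k"
    using shell.faces_homotopy_equivalent_sphere_wedge unfolding faces card by blast
  \<comment> \<open>The complex is finite, so its coherent topology is the subspace
    topology.\<close>
  moreover have "geometric_realization (neighborhood_complex (kneser_graph 3 k)) =
      top_of_set (underlying_set (union_complex (kneser_verts 3 k) (middle_sets k)))"
    unfolding neighborhood_complex_kneser_graph underlying_set_def
    using gen.simplicial_complex_union_complex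
    by (intro geometric_realization_finite) (simp add: simplicial_complex_def)
  ultimately show ?thesis
    using homotopy_eqv_trans[OF gen.union_complex_homotopy_equivalent_order_complex] by simp
qed

end
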